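(* Let $q$ be a complex number with $0<|q|<1$, with a fixed square root $q^{1/2}=\sqrt q$. Then $\mathcal{D}_q\mathcal{D}_q^{-1}$ is the identity operator on $L^2[(1-x^2)^{1/2},[-1,1]]$. That is, for every $g\in L^2[(1-x^2)^{1/2},[-1,1]]$ the function $\mathcal{D}_q^{-1}g$ is $q$-differentiable and $\mathcal{D}_q(\mathcal{D}_q^{-1}g)=g$ almost everywhere on $[-1,1]$.
   Context: For a weight $v$ on $[-1,1]$, $L^2[v,[-1,1]]$ denotes the space of (classes of) measurable functions $f$ on $[-1,1]$ with $\int_{-1}^1|f(x)|^2v(x)\,dx<\infty$. Powers of $q$ with half-integer exponents are $q^{n/2}=(q^{1/2})^n$. Chebyshev polynomials: for $x=\cos\theta$, $T_n(x)=\cos n\theta$ and $U_n(x)=\sin((n+1)\theta)/\sin\theta$. They are orthogonal on $[-1,1]$ with respect to $(1-x^2)^{-1/2}$ and $(1-x^2)^{1/2}$, respectively. Definition of $\mathcal{D}_q$: let $f\in L^2[(1-x^2)^{-1/2},[-1,1]]$ have Fourier-Chebyshev expansion $f(x)\sim\sum_{n=0}^\infty f_nT_n(x)$ (so $f_0=\frac1\pi\int_{-1}^1 f(x)(1-x^2)^{-1/2}dx$ and $f_n=\frac2\pi\int_{-1}^1 f(x)T_n(x)(1-x^2)^{-1/2}dx$ for $n\ge1$). The function $f$ is called $q$-differentiable if $$\sum_{n=0}^\infty\left|(1-q^n)q^{-n/2}f_n\right|^2<\infty .$$ In that case $\mathcal{D}_qf$ is the unique (almost everywhere) function in $L^2[(1-x^2)^{1/2},[-1,1]]$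 whose Fourier-Chebyshev expansion in the polynomials $U_{n-1}$ is $$(\mathcal{D}_qf)(x)\sim\sum_{n=1}^\infty\frac{q^{n/2}-q^{-n/2}}{q^{1/2}-q^{-1/2}}\,f_n\,U_{n-1}(x).$$ Definition of $\mathcal{D}_q^{-1}$: for a nome $p$ with $|p|<1$ let $\vartheta_4(z,p)=\sum_{n=-\infty}^{\infty}(-1)^np^{n^2}e^{2inz}$, and let $\vartheta_4'$ denote its derivative with respect to $z$. For $g\in L^2[(1-x^2)^{1/2},[-1,1]]$ and real $\theta$, $$(\mathcal{D}_q^{-1}g)(\cos\theta)=\frac{1-q}{4\pi\sqrt q}\int_{-\pi}^{\pi}\frac{\vartheta_4'((\theta+\phi)/2,\sqrt q)}{\vartheta_4((\theta+\phi)/2,\sqrt q)}\,g(\cos\phi)\,\sin\phi\,d\phi .$$ The right side is an even function of $\theta$, so this defines a function on $[-1,1]$. *)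

theory Defs
  imports "HOL-Analysis.Analysis"
begin

text \<open>
  Functions on \<open>[-1,1]\<close> are represented by functions \<open>real \<Rightarrow> complex\<close>; their values outside
  \<open>[-1,1]\<close> play no role. In all definitions \<open>r\<close> is the fixed square root of \<open>q\<close>, so that
  \<open>q\<^sup>n\<^sup>/\<^sup>2\<close> is \<open>r ^ n\<close>.
\<close>

definition L2_weight :: "(real \<Rightarrow> real) \<Rightarrow> (real \<Rightarrow> complex) set" where
  "L2_weight v = {f. f \<in> borel_measurable (lebesgue_on {-1..1}) \<and>
     integrable (lebesgue_on {-1..1}) (\<lambda>x. (norm (f x))\<^sup>2 * v x)}"

text \<open>At \<open>x = \<plusminus>1\<close> the weight \<open>wT\<close> takes the value \<open>0\<close> by the convention \<open>1 / 0 = 0\<close>.\<close>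

definition wT :: "real \<Rightarrow> real" where
  "wT x = 1 / sqrt (1 - x\<^sup>2)"

definition wU :: "real \<Rightarrow> real" where
  "wU x = sqrt (1 - x\<^sup>2)"

text \<open>
  The Chebyshev polynomials are given by their recurrences, so that \<open>cheb_U\<close> is also correct at
  \<open>x = \<plusminus>1\<close>; the lemmas below are the trigonometric identities that define them.
\<close>

fun cheb_T :: "nat \<Rightarrow> real \<Rightarrow> real" where
  "cheb_T 0 x = 1"
| "cheb_T (Suc 0) x = x"
| "cheb_T (Suc (Suc n)) x = 2 * x * cheb_T (Suc n) x - cheb_T n x"

fun cheb_U :: "nat \<Rightarrow> real \<Rightarrow> real" where
  "cheb_U 0 x = 1"
| "cheb_U (Suc 0) x = 2 * x"
| "cheb_U (Suc (Suc n)) x = 2 * x * cheb_U (Suc n) x - cheb_U n x"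

lemma cheb_T_cos: "cheb_T n (cos \<theta>) = cos (real n * \<theta>)"
proof (induction n rule: induct_nat_012)
  case (ge2 n)
  have 1: "real (Suc (Suc n)) * \<theta> = real (Suc n) * \<theta> + \<theta>"
    and 2: "real n * \<theta> = real (Suc n) * \<theta> - \<theta>"
    by (simp_all add: algebra_simps)
  show ?case
    using ge2 unfolding cheb_T.simps 1 by (simp only: 2 cos_add cos_diff) (simp add: algebra_simps)
qed simp_all

lemma cheb_U_cos_sin: "cheb_U n (cos \<theta>) * sin \<theta> = sin (real (n + 1) * \<theta>)"
proof (induction n rule: induct_nat_012)
  case 1
  show ?case by (simp add: sin_double)
next
  case (ge2 n)
  have 1: "real (Suc (Suc n) + 1) * \<theta> = real (Suc n + 1) * \<theta> + \<theta>"
    and 2: "real (n + 1) * \<theta> = real (Suc n + 1) * \<theta> - \<theta>"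
    by (simp_all add: algebra_simps)
  have "cheb_U (Suc (Suc n)) (cos \<theta>) * sin \<theta> =
      2 * cos \<theta> * (cheb_U (Suc n) (cos \<theta>) * sin \<theta>) - cheb_U n (cos \<theta>) * sin \<theta>"
    by (simp add: algebra_simps)
  also have "\<dots> = 2 * cos \<theta> * sin (real (Suc n + 1) * \<theta>) - sin (real (Suc n + 1) * \<theta> - \<theta>)"
    using ge2 2 by (simp only:)
  also have "\<dots> = sin (real (Suc n + 1) * \<theta> + \<theta>)"
    by (simp only: sin_add sin_diff) (simp add: algebra_simps)
  finally show ?case by (simp only: 1)
qed simp

corollary cheb_U_cos:
  assumes "sin \<theta> \<noteq> 0"
  shows "cheb_U n (cos \<theta>) = sin (real (n + 1) * \<theta>) / sin \<theta>"
  using assms cheb_U_cos_sin[of n \<theta>] by (simp add: field_simps)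

definition coeff_T :: "(real \<Rightarrow> complex) \<Rightarrow> nat \<Rightarrow> complex" where
  "coeff_T f n = of_real (if n = 0 then 1 / pi else 2 / pi) *
     (LINT x|lebesgue_on {-1..1}. f x * of_real (cheb_T n x * wT x))"

definition coeff_U :: "(real \<Rightarrow> complex) \<Rightarrow> nat \<Rightarrow> complex" where
  "coeff_U h n = of_real (2 / pi) *
     (LINT x|lebesgue_on {-1..1}. h x * of_real (cheb_U n x * wU x))"

definition q_differentiable :: "complex \<Rightarrow> complex \<Rightarrow> (real \<Rightarrow> complex) \<Rightarrow> bool" where
  "q_differentiable q r f \<longleftrightarrow> f \<in> L2_weight wT \<and>
     summable (\<lambda>n. (norm ((1 - q ^ n) * r powi (- int n) * coeff_T f n))\<^sup>2)"

text \<open>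
  \<open>\<D>\<^sub>q f\<close> is determined only up to null sets, so \<open>q_deriv\<close> chooses a representative.
\<close>

definition q_deriv :: "complex \<Rightarrow> (real \<Rightarrow> complex) \<Rightarrow> real \<Rightarrow> complex" where
  "q_deriv r f = (SOME h. h \<in> L2_weight wU \<and>
     (\<forall>n\<ge>1. coeff_U h (n - 1) =
        (r ^ n - r powi (- int n)) / (r - r powi (-1)) * coeff_T f n))"

definition theta4 :: "complex \<Rightarrow> complex \<Rightarrow> complex" where
  "theta4 z p = (\<Sum>\<^sub>\<infinity>n\<in>(UNIV :: int set). (-1) powi n * p powi (n\<^sup>2) * exp (2 * \<i> * of_int n * z))"

definition theta4' :: "complex \<Rightarrow> complex \<Rightarrow> complex" where
  "theta4' z p = deriv (\<lambda>w. theta4 w p) z"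

definition q_inv_integral ::
    "complex \<Rightarrow> complex \<Rightarrow> (real \<Rightarrow> complex) \<Rightarrow> real \<Rightarrow> complex" where
  "q_inv_integral q r g \<theta> = (1 - q) / (4 * of_real pi * r) *
     (LINT \<phi>|lebesgue_on {-pi..pi}.
        theta4' (of_real ((\<theta> + \<phi>) / 2)) r / theta4 (of_real ((\<theta> + \<phi>) / 2)) r
          * g (cos \<phi>) * of_real (sin \<phi>))"

text \<open>
  \<open>q_inv_integral q r g\<close> is even and \<open>2\<pi>\<close>-periodic in \<open>\<theta>\<close>, so any \<open>\<theta>\<close> with \<open>cos \<theta> = x\<close> gives the
  same value; \<open>arccos x\<close> is the one in \<open>[0,\<pi>]\<close>.
\<close>

definition q_deriv_inv ::
    "complex \<Rightarrow> complex \<Rightarrow> (real \<Rightarrow> complex) \<Rightarrow> real \<Rightarrow> complex" where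
  "q_deriv_inv q r g x = q_inv_integral q r g (arccos x)"

end

theory Submission imports Defs begin

text \<open>
  Comparing Fourier coefficients gives \<open>\<theta>\<^sub>4'/\<theta>\<^sub>4 (z, p) = 4 \<Sum> p\<^sup>n / (1 - p\<^sup>2\<^sup>n) sin (2nz)\<close> over \<open>n \<ge> 1\<close>,
  for real \<open>z\<close>. The product formula for \<open>\<theta>\<^sub>4\<close> is not needed: the identity between the coefficients of
  \<open>\<theta>\<^sub>4'\<close> and of \<open>\<theta>\<^sub>4\<close> times the right-hand side telescopes, and \<open>\<theta>\<^sub>4\<close> has no real zero because it
  solves a linear differential equation. Inserting this series into the integral and using that
  \<open>g (cos \<phi>) sin \<phi>\<close> is odd, one finds that the \<open>n\<close>-th Chebyshev coefficient of \<open>\<D>\<^sub>q\<^sup>-\<^sup>1 g\<close> is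
  \<open>(1 - q) / q\<^sup>1\<^sup>/\<^sup>2 * q\<^sup>n\<^sup>/\<^sup>2 / (1 - q\<^sup>n)\<close> times the coefficient of \<open>U\<^sub>n\<^sub>-\<^sub>1\<close> in \<open>g\<close>, and \<open>\<D>\<^sub>q\<close> divides by this
  factor. Bessel's inequality gives \<open>q\<close>-differentiability, and completeness of the polynomials \<open>U\<^sub>n\<close>
  identifies the result with \<open>g\<close>.
\<close>

section \<open>The logarithmic derivative of \<open>\<theta>\<^sub>4\<close>\<close>

lemma has_sum_int_split:
  fixes f :: "int \<Rightarrow> 'a :: {topological_ab_group_add, t2_space}"
  assumes "((\<lambda>n::nat. f (int n)) has_sum a) UNIV" "((\<lambda>n::nat. f (- int n)) has_sum b) UNIV"
  shows "(f has_sum (a + b - f 0)) UNIV"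
proof -
  have "(f has_sum a) (range int)"
    using assms(1) by (subst has_sum_reindex) (auto simp: o_def inj_on_def)
  moreover have "(f has_sum (b - f 0)) ((\<lambda>n. - int n) ` (UNIV - {0}))"
  proof -
    \<comment> \<open>Both one-sided sums contain the index 0; it is kept in the nonnegative half
      only.\<close>
    have "((\<lambda>n::nat. f (- int n)) has_sum (b - f 0)) (UNIV - {0})"
      using has_sum_Diff[OF assms(2), of "{0}" "f 0"] by (simp add: has_sum_finiteI)
    thus ?thesis by (subst has_sum_reindex) (auto simp: o_def inj_on_def)
  qed
  moreover have "range int \<inter> (\<lambda>n. - int n) ` (UNIV - {0}) = {}" by auto
  ultimately have "(f has_sum (a + (b - f 0))) (range int \<union> (\<lambda>n. - int n) ` (UNIV - {0}))"
    by (rule has_sum_Un_disjoint)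
  moreover have "range int \<union> (\<lambda>n. - int n) ` (UNIV - {0}) = UNIV"
  proof (intro equalityI subsetI UNIV_I)
    fix k :: int
    show "k \<in> range int \<union> (\<lambda>n. - int n) ` (UNIV - {0})"
    proof (cases "k \<ge> 0")
      case True
      thus ?thesis by (metis UnI1 nonneg_int_cases rangeI)
    next
      case False
      hence "k = - int (nat (-k))" "nat (-k) \<in> UNIV - {0}" by auto
      thus ?thesis by (metis UnI2 image_eqI)
    qed
  qed
  ultimately show ?thesis by (simp add: algebra_simps)
qed

lemma summable_on_geometric_int:
  fixes x :: real
  assumes "0 \<le> x" "x < 1"
  shows "(\<lambda>n::int. x ^ nat \<bar>n\<bar>) summable_on UNIV"
proof -
  have "summable (\<lambda>n. norm (x ^ n))" using assms by (simp add: summable_geometric)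
  hence "((\<lambda>n. x ^ n) has_sum (\<Sum>n. x ^ n)) UNIV"
    by (intro norm_summable_imp_has_sum) (auto simp: assms summable_geometric summable_sums)
  thus ?thesis using has_sum_int_split[of "\<lambda>n. x ^ nat \<bar>n\<bar>"] by (auto simp: summable_on_def)
qed

text \<open>The quadratic exponent beats a linear one: with B = |b| + 1, expanding the square of |n|
  - B gives B |n| \<le> n^2 + B^2, hence n^2 - b n \<ge> |n| - B^2, and a geometric series
  dominates.\<close>

lemma summable_on_gaussian:
  fixes a :: real and b :: int
  assumes "0 < a" "a < 1"
  shows "(\<lambda>n::int. a powi (n\<^sup>2 - b * n)) summable_on UNIV"
proof (rule summable_on_comparison_test)
  show "(\<lambda>n::int. a powi (- (\<bar>b\<bar> + 1)\<^sup>2) * a ^ nat \<bar>n\<bar>) summable_on UNIV"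
    using assms by (intro summable_on_cmult_right summable_on_geometric_int) auto
  fix n :: int
  have "b * n \<le> \<bar>b\<bar> * \<bar>n\<bar>" by (metis abs_ge_self abs_mult)
  moreover have "(\<bar>b\<bar> + 1) * \<bar>n\<bar> \<le> n\<^sup>2 + (\<bar>b\<bar> + 1)\<^sup>2"
  proof -
    have "0 \<le> (\<bar>n\<bar> - (\<bar>b\<bar> + 1))\<^sup>2" "0 \<le> (\<bar>b\<bar> + 1) * \<bar>n\<bar>" by auto
    hence "0 \<le> (\<bar>n\<bar> - (\<bar>b\<bar> + 1))\<^sup>2 + (\<bar>b\<bar> + 1) * \<bar>n\<bar>" by (rule add_nonneg_nonneg)
    thus ?thesis by (simp add: power2_diff algebra_simps)
  qed
  ultimately have "- (\<bar>b\<bar> + 1)\<^sup>2 + \<bar>n\<bar> \<le> n\<^sup>2 - b * n" by (simp add: algebra_simps)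
  hence "a powi (n\<^sup>2 - b * n) \<le> a powi (- (\<bar>b\<bar> + 1)\<^sup>2 + \<bar>n\<bar>)"
    using assms by (intro power_int_decreasing) auto
  also have "\<dots> = a powi (- (\<bar>b\<bar> + 1)\<^sup>2) * a powi \<bar>n\<bar>"
    using assms by (subst power_int_add) auto
  also have "a powi \<bar>n\<bar> = a ^ nat \<bar>n\<bar>" by (simp add: power_int_def)
  finally show "a powi (n\<^sup>2 - b * n) \<le> a powi (- (\<bar>b\<bar> + 1)\<^sup>2) * a ^ nat \<bar>n\<bar>" .
  show "0 \<le> a powi (n\<^sup>2 - b * n)" using assms by simp
qed

text \<open>The value at \<open>n = 0\<close> is \<open>0\<close>, by the convention \<open>1 / 0 = 0\<close>.\<close>

definition lambert :: "complex \<Rightarrow> int \<Rightarrow> complex" where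
  "lambert p n = 1 / (p powi (- n) - p powi n)"

lemma lambert_0 [simp]: "lambert p 0 = 0"
  by (simp add: lambert_def)

lemma lambert_minus: "lambert p (- n) = - lambert p n"
  by (simp add: lambert_def minus_divide_right)

lemma lambert_nat:
  assumes "p \<noteq> 0"
  shows "lambert p (int n) = p ^ n / (1 - p ^ (2 * n))"
proof -
  have "lambert p (int n) = p ^ n / (p ^ n * (inverse (p ^ n) - p ^ n))"
    using assms by (simp add: lambert_def power_int_minus)
  also have "p ^ n * (inverse (p ^ n) - p ^ n) = 1 - p ^ (2 * n)"
    using assms by (simp add: right_diff_distrib mult_2 power_add)
  finally show ?thesis .
qed

lemma power_int_diff_ne_0:
  assumes "0 < norm p" "norm p < 1" "n \<noteq> 0"
  shows "p powi (- n) - p powi n \<noteq> (0 :: complex)"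
proof
  assume "p powi (- n) - p powi n = 0"
  hence "norm p powi (- n) = norm p powi n"
    by (metis eq_iff_diff_eq_0 norm_power_int)
  moreover have "norm p powi (-n) \<noteq> norm p powi n"
    using assms power_int_strict_decreasing[of "-n" n "norm p"]
      power_int_strict_decreasing[of "n" "-n" "norm p"] by (cases "n > 0") auto
  ultimately show False by simp
qed

text \<open>For n \<ge> 1 the denominator satisfies |1 - p^(2n)| \<ge> 1 - |p|^(2n) \<ge> 1 - |p|;
  negative indices follow by oddness. This geometric decay drives the later interchanges of sum with
  product, derivative and integral.\<close>

lemma norm_lambert_le:
  assumes "0 < norm p" "norm p < 1"
  shows "norm (lambert p n) \<le> norm p ^ nat \<bar>n\<bar> / (1 - norm p)"
proof -
  have nat: "norm (lambert p (int m)) \<le> norm p ^ m / (1 - norm p)" for m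
  proof (cases "m = 0")
    case False
    have "norm p ^ (2 * m) \<le> norm p ^ 1" using False assms by (intro power_decreasing) auto
    moreover have "1 - norm p ^ (2 * m) \<le> norm (1 - p ^ (2 * m))"
      by (metis norm_one norm_power norm_triangle_ineq2)
    ultimately have "1 - norm p \<le> norm (1 - p ^ (2 * m))" by simp
    thus ?thesis using assms
      by (auto simp: lambert_nat norm_divide norm_power intro!: divide_left_mono mult_pos_pos)
  qed (use assms in auto)
  show ?thesis
  proof (cases "n \<ge> 0")
    case True
    thus ?thesis using nat[of "nat n"] by simp
  next
    case False
    thus ?thesis using nat[of "nat (- n)"] by (simp add: lambert_minus)
  qed
qed

lemma norm_lambert_le':
  assumes "0 < norm p" "norm p < 1"
  shows "norm (lambert p n) \<le> 1 / (1 - norm p)"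
proof -
  have "norm p ^ nat \<bar>n\<bar> / (1 - norm p) \<le> 1 / (1 - norm p)"
    using assms by (intro divide_right_mono power_le_one) auto
  with norm_lambert_le[OF assms, of n] show ?thesis by linarith
qed

text \<open>The reflection n \<mapsto> a - n preserves the exponent n^2 - a n and, as a is odd,
  flips the sign. The sum therefore equals its own negative.\<close>

lemma has_sum_gaussian_odd:
  fixes p :: complex
  assumes "0 < norm p" "norm p < 1" "odd a"
  shows "((\<lambda>n::int. (-1) powi n * p powi (n\<^sup>2 - a * n)) has_sum 0) UNIV"
proof -
  let ?f = "\<lambda>n::int. (-1) powi n * p powi (n\<^sup>2 - a * n)"
  have "(\<lambda>n. norm (?f n)) summable_on UNIV"
    using summable_on_gaussian[OF assms(1,2), of a] by (simp add: norm_mult norm_power_int)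
  then have "?f summable_on UNIV" by (rule Infinite_Sum.abs_summable_summable)
  then obtain s where s: "(?f has_sum s) UNIV" by (auto simp: summable_on_def)
  have "bij_betw (\<lambda>n. a - n) UNIV UNIV" by (rule bij_betwI[of _ _ _ "\<lambda>n. a - n"]) auto
  from has_sum_reindex_bij_betw[OF this, of ?f s] s
  have "((\<lambda>n. ?f (a - n)) has_sum s) UNIV" by simp
  moreover have "?f (a - n) = - ?f n" for n
  proof -
    have "(a - n)\<^sup>2 - a * (a - n) = n\<^sup>2 - a * n" by (simp add: power2_eq_square algebra_simps)
    moreover have "(-1 :: complex) powi (a - n) = - ((-1) powi n)"
      using assms(3) by (simp add: power_int_minus_one_diff_commute power_int_minus_left)
    ultimately show ?thesis by simp
  qed
  ultimately have "((\<lambda>n. - ?f n) has_sum s) UNIV" by simp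
  moreover have "((\<lambda>n. - ?f n) has_sum - s) UNIV" using s by (simp only: has_sum_uminus minus_minus)
  ultimately have "s = - s" by (rule has_sum_unique)
  thus ?thesis using s by simp
qed

text \<open>The sum decreases by \<open>1\<close> when \<open>m\<close> increases by \<open>1\<close>: the difference of the terms cancels the
  denominator of \<open>lambert p n\<close>, and the substitution \<open>n \<mapsto> 2 * m - 1 - n\<close> shows that the remaining
  Gaussian sum, completed by its term at \<open>n = 0\<close>, vanishes.\<close>

lemma has_sum_lambert_gaussian:
  fixes p :: complex
  assumes "0 < norm p" "norm p < 1"
  shows "((\<lambda>n::int. lambert p n * ((-1) powi n * p powi (n\<^sup>2 - 2 * m * n))) has_sum (- of_int m)) UNIV"
proof -
  define f where "f = (\<lambda>m n::int. lambert p n * ((-1) powi n * p powi (n\<^sup>2 - 2 * m * n)))"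
  define F where "F m = infsum (f m) UNIV" for m
  have p: "p \<noteq> 0" using assms by auto
  have F: "(f m has_sum F m) UNIV" for m
  proof -
    have "(\<lambda>n. norm (f m n)) summable_on UNIV"
    proof (rule summable_on_comparison_test)
      show "(\<lambda>n. 1 / (1 - norm p) * norm p powi (n\<^sup>2 - (2 * m) * n)) summable_on UNIV"
        by (intro summable_on_cmult_right summable_on_gaussian assms)
      fix n
      show "norm (f m n) \<le> 1 / (1 - norm p) * norm p powi (n\<^sup>2 - (2 * m) * n)"
        unfolding f_def norm_mult norm_power_int
        using norm_lambert_le'[OF assms, of n] by (simp add: mult_right_mono del: times_divide_eq_left)
    qed auto
    then have "f m summable_on UNIV" by (rule Infinite_Sum.abs_summable_summable)
    thus ?thesis unfolding F_def by (rule has_sum_infsum)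
  qed
  \<comment> \<open>Starting value of the recursion: for m = 0 the summand is odd in n.\<close>
  have "F 0 = 0"
  proof -
    have "bij_betw (\<lambda>n::int. - n) UNIV UNIV" by (rule bij_betwI[of _ _ _ "\<lambda>n. - n"]) auto
    from has_sum_reindex_bij_betw[OF this, of "f 0" "F 0"] F[of 0]
    have "((\<lambda>n. f 0 (-n)) has_sum F 0) UNIV" by simp
    moreover have "f 0 (- n) = - f 0 n" for n
      by (simp add: f_def lambert_minus power_int_minus flip: power_int_inverse)
    ultimately have "((\<lambda>n. - f 0 n) has_sum F 0) UNIV" by simp
    moreover have "((\<lambda>n. - f 0 n) has_sum - F 0) UNIV"
      using F[of 0] by (simp only: has_sum_uminus minus_minus)
    ultimately have "F 0 = - F 0" by (rule has_sum_unique)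
    thus ?thesis by simp
  qed
  have step: "F m - F (m - 1) = - 1" for m
  proof -
    let ?g = "\<lambda>n::int. (-1) powi n * p powi (n\<^sup>2 - (2 * m - 1) * n)"
    have "((\<lambda>n. f m n + - f (m - 1) n) has_sum (F m + - F (m - 1))) UNIV"
      using F by (intro has_sum_add) (simp_all add: has_sum_uminus)
    moreover have "f m n + - f (m - 1) n = ?g n + (if n = 0 then - 1 else 0)" for n
    proof (cases "n = 0")
      case False
      \<comment> \<open>Both exponents are written relative to the odd number 2m - 1 that lies
        halfway between 2m and 2(m - 1).\<close>
      have 1: "p powi (n\<^sup>2 - 2 * m * n) = p powi (n\<^sup>2 - (2 * m - 1) * n) * p powi (- n)"
        using p by (simp add: power_int_add[symmetric] algebra_simps)
      have 2: "p powi (n\<^sup>2 - 2 * (m - 1) * n) = p powi (n\<^sup>2 - (2 * m - 1) * n) * p powi n"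
        using p by (simp add: power_int_add[symmetric] algebra_simps)
      have "f m n + - f (m - 1) n = ?g n * (lambert p n * (p powi (- n) - p powi n))"
        unfolding f_def 1 2 by (simp add: algebra_simps)
      also have "lambert p n * (p powi (- n) - p powi n) = 1"
        using power_int_diff_ne_0[OF assms False] by (simp add: lambert_def)
      finally show ?thesis using False by simp
    qed (simp add: f_def)
    ultimately have "((\<lambda>n. ?g n + (if n = 0 then - 1 else 0)) has_sum (F m + - F (m - 1))) UNIV" by simp
    moreover have "((\<lambda>n. ?g n + (if n = 0 then - 1 else 0)) has_sum (0 + - 1)) UNIV"
    proof (intro has_sum_add has_sum_gaussian_odd assms)
      show "((\<lambda>n::int. if n = 0 then - 1 else 0 :: complex) has_sum - 1) UNIV"
        by (rule has_sum_finite_neutralI[of "{0}"]) auto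
    qed simp
    ultimately have "F m + - F (m - 1) = 0 + - 1" by (rule has_sum_unique)
    thus ?thesis by simp
  qed
  have "F m = - of_int m" for m
  proof (induction m rule: int_induct[of _ 0])
    case (step1 i)
    thus ?case using step[of "i + 1"] by (simp add: algebra_simps)
  next
    case (step2 i)
    thus ?case using step[of i] by (simp add: algebra_simps)
  qed (use \<open>F 0 = 0\<close> in simp)
  thus ?thesis using F[of m] by (simp add: f_def)
qed

section \<open>Fourier series with geometrically decaying coefficients\<close>

definition fourier_series :: "(int \<Rightarrow> complex) \<Rightarrow> complex \<Rightarrow> complex" where
  "fourier_series c z = (\<Sum>\<^sub>\<infinity>n\<in>(UNIV :: int set). c n * exp (2 * \<i> * of_int n * z))"

lemma exp_of_int_mult:
  "exp (2 * \<i> * of_int (int n) * z) = exp (2 * \<i> * z) ^ n"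
  "exp (2 * \<i> * of_int (- int n) * z) = exp (- (2 * \<i> * z)) ^ n"
  by (simp_all add: exp_of_nat_mult[symmetric] algebra_simps)

lemma norm_exp_of_int_real [simp]: "norm (exp (2 * \<i> * of_int n * of_real x)) = 1"
  by (simp add: norm_exp_eq_Re)

lemma has_sum_powser:
  fixes a :: "nat \<Rightarrow> complex"
  assumes "summable (\<lambda>n. norm (a n * w ^ n))"
  shows "((\<lambda>n. a n * w ^ n) has_sum (\<Sum>n. a n * w ^ n)) UNIV"
  by (rule norm_summable_imp_has_sum[OF assms summable_sums[OF summable_norm_cancel[OF assms]]])

lemma has_sum_fourier_series_bounded:
  assumes "\<And>n. norm (c n) \<le> C * \<rho> ^ nat \<bar>n\<bar>" "0 \<le> \<rho>" "\<rho> < 1"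
  shows "((\<lambda>n. c n * exp (2 * \<i> * of_int n * of_real x)) has_sum fourier_series c (of_real x)) UNIV"
    and "(\<lambda>n. norm (c n * exp (2 * \<i> * of_int n * of_real x))) summable_on UNIV"
proof -
  show *: "(\<lambda>n. norm (c n * exp (2 * \<i> * of_int n * of_real x))) summable_on UNIV"
  proof (rule summable_on_comparison_test)
    show "(\<lambda>n::int. C * \<rho> ^ nat \<bar>n\<bar>) summable_on UNIV"
      using assms by (intro summable_on_cmult_right summable_on_geometric_int) auto
  qed (use assms(1) in \<open>simp_all add: norm_mult\<close>)
  show "((\<lambda>n. c n * exp (2 * \<i> * of_int n * of_real x)) has_sum fourier_series c (of_real x)) UNIV"
    unfolding fourier_series_def by (rule has_sum_infsum[OF Infinite_Sum.abs_summable_summable[OF *]])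
qed

text \<open>The series is a sum of two power series, in e^(2iz) and in e^(-2iz). Geometric decay
  makes both radii of convergence exceed 1, while both arguments have modulus 1 on the real line, so
  a complex neighbourhood of each real point is covered and termwise differentiation
  applies.\<close>

lemma has_field_derivative_fourier_series:
  assumes bnd: "\<And>n. norm (c n) \<le> C * \<rho> ^ nat \<bar>n\<bar>" and "0 \<le> \<rho>" "\<rho> < 1"
  shows "(fourier_series c has_field_derivative
      fourier_series (\<lambda>n. 2 * \<i> * of_int n * c n) (of_real x)) (at (of_real x))"
proof -
  \<comment> \<open>Any K with 1 < K and \<rho> K < 1 would do; this choice also covers \<rho> =
    0.\<close>
  define K where "K = 2 / (1 + \<rho>)"
  have K: "K > 1" "\<rho> * K < 1" using assms by (auto simp: K_def field_simps)
  define a b where "a = (\<lambda>n. c (int n))" and "b = (\<lambda>n. c (- int n))"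
  have ns: "summable (\<lambda>n. norm (d n * w ^ n))"
    if "\<And>n. norm (d n) \<le> C * \<rho> ^ n" "norm w < K" for d :: "nat \<Rightarrow> complex" and w
  proof (rule summable_comparison_test)
    have "\<rho> * norm w \<le> \<rho> * K" using that assms by (intro mult_left_mono) auto
    hence "\<rho> * norm w < 1" using K by simp
    thus "summable (\<lambda>n. C * (\<rho> * norm w) ^ n)"
      using assms by (intro summable_mult summable_geometric) auto
    show "\<exists>N. \<forall>n\<ge>N. norm (norm (d n * w ^ n)) \<le> C * (\<rho> * norm w) ^ n"
      using that by (auto simp: norm_mult norm_power power_mult_distrib mult.assoc[symmetric]
          intro!: mult_right_mono)
  qed
  have nsa: "summable (\<lambda>n. norm (a n * w ^ n))" "summable (\<lambda>n. norm (b n * w ^ n))"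
    if "norm w < K" for w
    using bnd[of "int _"] bnd[of "- int _"] that by (auto intro!: ns simp: a_def b_def)
  define A B where "A = (\<lambda>w. \<Sum>n. a n * w ^ n)" and "B = (\<lambda>w. \<Sum>n. b n * w ^ n)"
  let ?S = "{z. norm (exp (2 * \<i> * z)) < K \<and> norm (exp (- (2 * \<i> * z))) < K}"
  have "open ?S" by (intro open_Collect_conj open_Collect_less continuous_intros)
  have xS: "of_real x \<in> ?S" using K by (simp add: norm_exp_eq_Re)
  have eq: "fourier_series c z = A (exp (2 * \<i> * z)) + B (exp (- (2 * \<i> * z))) - c 0" if "z \<in> ?S" for z
    unfolding fourier_series_def A_def B_def
  proof (rule infsumI, rule has_sum_int_split[of "\<lambda>n. c n * exp (2 * \<i> * of_int n * z)", simplified])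
    show "((\<lambda>n. c (int n) * exp (2 * \<i> * of_nat n * z)) has_sum (\<Sum>n. a n * exp (2 * \<i> * z) ^ n)) UNIV"
      using has_sum_powser[OF nsa(1)[of "exp (2 * \<i> * z)"]] that exp_of_int_mult(1)[of _ z]
      by (simp add: a_def)
    show "((\<lambda>n. c (- int n) * exp (- (2 * \<i> * of_nat n * z))) has_sum (\<Sum>n. b n * exp (- (2 * \<i> * z)) ^ n)) UNIV"
      using has_sum_powser[OF nsa(2)[of "exp (- (2 * \<i> * z))"]] that exp_of_int_mult(2)[of _ z]
      by (simp add: b_def)
  qed
  \<comment> \<open>The series is given for \<open>w * D\<close> rather than for \<open>D\<close>,
    so that its n-th term carries w^n and no index shift is left when the two halves are
    recombined.\<close>
  have D: "\<exists>D. ((\<lambda>w. \<Sum>n. d n * w ^ n) has_field_derivative D) (at w) \<and>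
      ((\<lambda>n. of_nat n * d n * w ^ n) has_sum (w * D)) UNIV"
    if d: "\<And>w. norm w < K \<Longrightarrow> summable (\<lambda>n. norm (d n * w ^ n))" and w: "norm w = 1"
    for d :: "nat \<Rightarrow> complex" and w
  proof (intro exI conjI)
    have sm: "summable (\<lambda>n. d n * w ^ n)" if "norm w < K" for w
      using d[OF that] by (rule summable_norm_cancel)
    obtain k where k: "1 < k" "k < K" using K dense by blast
    have "((\<lambda>w. \<Sum>n. d n * w ^ n) has_field_derivative (\<Sum>n. diffs d n * w ^ n)) (at w)"
      using k w by (intro termdiffs_strong[of _ "of_real k"] sm) auto
    thus "((\<lambda>w. \<Sum>n. d n * w ^ n) has_field_derivative (\<Sum>n. diffs d n * w ^ n)) (at w)" .
    have sums: "(\<lambda>n. (of_nat n * d n) * u ^ n) sums (u * (\<Sum>n. diffs d n * u ^ n))" if "norm u < K" for u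
    proof -
      have "summable (\<lambda>n. diffs d n * u ^ n)"
        using that sm by (intro termdiff_converges[of _ K]) auto
      from sums_mult[OF diffs_equiv[OF this], of u]
      have "(\<lambda>n. u * (of_nat n * d n * u ^ (n - Suc 0))) sums (u * (\<Sum>n. diffs d n * u ^ n))" .
      moreover have "u * (of_nat n * d n * u ^ (n - Suc 0)) = (of_nat n * d n) * u ^ n" for n
        by (cases n) auto
      ultimately show ?thesis by simp
    qed
    \<comment> \<open>Convergence at the radius k > 1 upgrades to absolute convergence on the unit
      circle, as the unordered sum requires.\<close>
    have "summable (\<lambda>n. norm ((of_nat n * d n) * w ^ n))"
      using sums_summable[OF sums[of "of_real k"]] k w
      by (intro powser_insidea[of "\<lambda>n. of_nat n * d n" "of_real k"]) auto
    thus "((\<lambda>n. of_nat n * d n * w ^ n) has_sum (w * (\<Sum>n. diffs d n * w ^ n))) UNIV"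
      using sums[of w] w K by (intro norm_summable_imp_has_sum) auto
  qed
  let ?e = "exp (2 * \<i> * of_real x)" and ?e' = "exp (- (2 * \<i> * of_real x))"
  have e: "norm ?e = 1" "norm ?e' = 1" by (simp_all add: norm_exp_eq_Re)
  obtain DA where DA: "(A has_field_derivative DA) (at ?e)"
    "((\<lambda>n. of_nat n * a n * ?e ^ n) has_sum (?e * DA)) UNIV"
    using D[OF nsa(1) e(1)] unfolding A_def by blast
  obtain DB where DB: "(B has_field_derivative DB) (at ?e')"
    "((\<lambda>n. of_nat n * b n * ?e' ^ n) has_sum (?e' * DB)) UNIV"
    using D[OF nsa(2) e(2)] unfolding B_def by blast
  have "((\<lambda>z. A (exp (2 * \<i> * z)) + B (exp (- (2 * \<i> * z))) - c 0) has_field_derivative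
      DA * (?e * (2 * \<i>)) + DB * (?e' * (- (2 * \<i>)))) (at (of_real x))"
  proof -
    have "((\<lambda>z. exp (2 * \<i> * z)) has_field_derivative ?e * (2 * \<i>)) (at (of_real x))"
      and "((\<lambda>z. exp (- (2 * \<i> * z))) has_field_derivative ?e' * (- (2 * \<i>))) (at (of_real x))"
      by (auto intro!: derivative_eq_intros)
    from DERIV_diff[OF DERIV_add DERIV_const,
        OF DERIV_chain2[where g = "\<lambda>z. exp (2 * \<i> * z)", OF DA(1) this(1)]
          DERIV_chain2[where g = "\<lambda>z. exp (- (2 * \<i> * z))", OF DB(1) this(2)], of "c 0"]
    show ?thesis by simp
  qed
  hence "(fourier_series c has_field_derivative
      DA * (?e * (2 * \<i>)) + DB * (?e' * (- (2 * \<i>)))) (at (of_real x))"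
    by (rule has_field_derivative_transform_within_open[OF _ \<open>open ?S\<close> xS]) (use eq in simp)
  moreover have "fourier_series (\<lambda>n. 2 * \<i> * of_int n * c n) (of_real x) =
      DA * (?e * (2 * \<i>)) + DB * (?e' * (- (2 * \<i>)))"
    unfolding fourier_series_def
  proof (rule infsumI)
    let ?f = "\<lambda>n. 2 * \<i> * of_int n * c n * exp (2 * \<i> * of_int n * of_real x)"
    have "((\<lambda>n. ?f (int n)) has_sum (2 * \<i> * (?e * DA))) UNIV"
      using has_sum_cmult_right[OF DA(2), of "2 * \<i>"] 
      unfolding exp_of_int_mult by (simp add: a_def mult_ac)
    moreover have "((\<lambda>n. ?f (- int n)) has_sum (- 2 * \<i> * (?e' * DB))) UNIV"
      using has_sum_cmult_right[OF DB(2), of "- 2 * \<i>"]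
      unfolding exp_of_int_mult by (simp add: b_def mult_ac)
    ultimately show "(?f has_sum (DA * (?e * (2 * \<i>)) + DB * (?e' * (- (2 * \<i>))))) UNIV"
      using has_sum_int_split[of ?f "2 * \<i> * (?e * DA)" "- 2 * \<i> * (?e' * DB)"] by (simp add: mult_ac)
  qed
  ultimately show ?thesis by simp
qed

section \<open>The differential equation of \<open>theta4\<close> on the real line\<close>

lemma norm_theta4_coeff_le:
  assumes "0 < norm p" "norm p < 1"
  shows "norm ((-1) powi n * p powi (n\<^sup>2) :: complex) \<le> 1 * norm p ^ nat \<bar>n\<bar>"
proof -
  have "norm p powi (n\<^sup>2) \<le> norm p powi \<bar>n\<bar>"
  proof (rule power_int_decreasing)
    have "\<bar>n\<bar> * 1 \<le> \<bar>n\<bar> * \<bar>n\<bar>" by (cases "n = 0", simp, intro mult_left_mono) auto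
    thus "\<bar>n\<bar> \<le> n\<^sup>2" by (simp add: power2_eq_square abs_mult_self_eq)
  qed (use assms in auto)
  moreover have "norm p powi \<bar>n\<bar> = norm p ^ nat \<bar>n\<bar>" by (simp add: power_int_def)
  ultimately show ?thesis by (simp add: norm_mult norm_power_int)
qed

lemma theta4_eq_fourier_series: "(\<lambda>z. theta4 z p) = fourier_series (\<lambda>n. (-1) powi n * p powi (n\<^sup>2))"
  by (simp add: fun_eq_iff theta4_def fourier_series_def)

lemma has_sum_prod:
  fixes f :: "'a \<Rightarrow> complex" and g :: "'b \<Rightarrow> complex"
  assumes f: "(f has_sum a) A" "(\<lambda>x. norm (f x)) summable_on A"
    and g: "(g has_sum b) B" "(\<lambda>x. norm (g x)) summable_on B"
  shows "((\<lambda>(x, y). f x * g y) has_sum (a * b)) (A \<times> B)"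
proof (rule has_sum_SigmaI[where g = "\<lambda>x. f x * b"])
  show "((\<lambda>y. case (x, y) of (x, y) \<Rightarrow> f x * g y) has_sum f x * b) B" for x
    using has_sum_cmult_right[OF g(1)] by simp
  show "((\<lambda>x. f x * b) has_sum a * b) A" by (rule has_sum_cmult_left[OF f(1)])
  have "(\<lambda>z. norm (case z of (x, y) \<Rightarrow> f x * g y)) summable_on A \<times> B"
    unfolding Infinite_Sum.abs_summable_on_Sigma_iff
    using f(2) g(2)
    by (auto simp: norm_mult infsum_cmult_right' abs_mult intro!: summable_on_cmult_right summable_on_cmult_left)
  thus "(\<lambda>(x, y). f x * g y) summable_on A \<times> B" by (rule Infinite_Sum.abs_summable_summable)
qed

text \<open>Cauchy product. In the coefficient of index m, the splitting (m - n)^2 = m^2 + (n^2 -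
  2mn) factors out the m-th coefficient of \<open>theta4\<close>, and
  \<open>has_sum_lambert_gaussian\<close> evaluates what remains to -m.\<close>

lemma has_sum_theta4_lambert:
  assumes p: "0 < norm p" "norm p < 1"
  shows "((\<lambda>m. - of_int m * (((-1) powi m * p powi (m\<^sup>2)) * exp (2 * \<i> * of_int m * of_real x)))
    has_sum theta4 (of_real x) p * fourier_series (lambert p) (of_real x)) UNIV"
proof -
  define c where "c = (\<lambda>n::int. (-1) powi n * p powi (n\<^sup>2))"
  define e where "e = (\<lambda>n::int. exp (2 * \<i> * of_int n * complex_of_real x))"
  have p0: "p \<noteq> 0" using p by auto
  have lam: "norm (lambert p n) \<le> (1 / (1 - norm p)) * norm p ^ nat \<bar>n\<bar>" for n
    using norm_lambert_le[OF p, of n] by simp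
  note 1 = has_sum_fourier_series_bounded[OF norm_theta4_coeff_le[OF p], of x]
  note 2 = has_sum_fourier_series_bounded[OF lam, of x]
  have "((\<lambda>(k, n). (c k * e k) * (lambert p n * e n)) has_sum
      (theta4 (of_real x) p * fourier_series (lambert p) (of_real x))) (UNIV \<times> UNIV)"
    using has_sum_prod[OF 1 2] p unfolding theta4_eq_fourier_series[THEN fun_cong] c_def e_def by simp
  \<comment> \<open>Regroups the double sum by the total frequency m = k + n.\<close>
  moreover have "bij_betw (\<lambda>(m, n). (m - n, n)) (UNIV \<times> UNIV) (UNIV \<times> (UNIV :: int set))"
    by (rule bij_betwI[of _ _ _ "\<lambda>(k, n). (k + n, n)"]) auto
  ultimately have "((\<lambda>z. (\<lambda>(k, n). (c k * e k) * (lambert p n * e n)) ((\<lambda>(m, n). (m - n, n)) z)) has_sum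
      (theta4 (of_real x) p * fourier_series (lambert p) (of_real x))) (UNIV \<times> UNIV)"
    by (subst has_sum_reindex_bij_betw)
  hence "((\<lambda>m. - of_int m * (c m * e m)) has_sum
      (theta4 (of_real x) p * fourier_series (lambert p) (of_real x))) UNIV"
  proof (rule has_sum_SigmaD)
    fix m :: int
    have "c (m - n) * e (m - n) * (lambert p n * e n) =
        c m * e m * (lambert p n * ((-1) powi n * p powi (n\<^sup>2 - 2 * m * n)))" for n
    proof -
      have "e (m - n) * e n = e m" by (simp add: e_def exp_add[symmetric] algebra_simps)
      moreover have "p powi ((m - n)\<^sup>2) = p powi (m\<^sup>2) * p powi (n\<^sup>2 - 2 * m * n)"
        using p0 by (simp add: power_int_add[symmetric] power2_diff algebra_simps)
      moreover have "(-1 :: complex) powi (m - n) = (-1) powi m * (-1) powi n"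
        by (simp add: power_int_diff power_int_minus_left)
      ultimately have "c (m - n) * (e (m - n) * e n) = c m * e m * ((-1) powi n * p powi (n\<^sup>2 - 2 * m * n))"
        by (simp add: c_def)
      thus ?thesis by (metis (no_types) mult.assoc mult.left_commute)
    qed
    moreover have "((\<lambda>n. c m * e m * (lambert p n * ((-1) powi n * p powi (n\<^sup>2 - 2 * m * n)))) has_sum
        (c m * e m * (- of_int m))) UNIV"
      by (intro has_sum_cmult_right has_sum_lambert_gaussian p)
    ultimately have "((\<lambda>n. c (m - n) * e (m - n) * (lambert p n * e n)) has_sum
        (c m * e m * (- of_int m))) UNIV" by (simp only:)
    thus "((\<lambda>n. case case (m, n) of (m, n) \<Rightarrow> (m - n, n) of
        (k, n) \<Rightarrow> c k * e k * (lambert p n * e n)) has_sum - of_int m * (c m * e m)) UNIV"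
      by (simp add: mult_ac)
  qed
  thus ?thesis by (simp add: c_def e_def)
qed

text \<open>Differentiation multiplies the m-th coefficient by 2im, which is -2i times the factor -m
  of the product series.\<close>

lemma has_field_derivative_theta4:
  assumes p: "0 < norm p" "norm p < 1"
  shows "((\<lambda>z. theta4 z p) has_field_derivative
    - 2 * \<i> * theta4 (of_real x) p * fourier_series (lambert p) (of_real x)) (at (of_real x))"
proof -
  have "fourier_series (\<lambda>n. 2 * \<i> * of_int n * ((-1) powi n * p powi (n\<^sup>2))) (of_real x) =
    - 2 * \<i> * (theta4 (of_real x) p * fourier_series (lambert p) (of_real x))"
    using has_sum_cmult_right[OF has_sum_theta4_lambert[OF p, of x], of "- 2 * \<i>"]
    unfolding fourier_series_def by (intro infsumI) (simp add: mult_ac)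
  thus ?thesis
    using has_field_derivative_fourier_series[OF norm_theta4_coeff_le[OF p], of x] p
    unfolding theta4_eq_fourier_series[symmetric] by (simp add: mult_ac)
qed

text \<open>Dividing by 2in integrates a Fourier series termwise; at n = 0 the quotient is 0 by
  convention, so the constant term is dropped.\<close>

lemma norm_divide_index_le:
  assumes "\<And>n. norm (c n) \<le> C * \<rho> ^ nat \<bar>n\<bar>"
  shows "norm (c n / (2 * \<i> * of_int n)) \<le> C * \<rho> ^ nat \<bar>n\<bar>"
proof (cases "n = 0")
  case False
  hence "1 \<le> \<bar>real_of_int n\<bar>" by linarith
  hence "norm (c n) / (2 * \<bar>real_of_int n\<bar>) \<le> norm (c n) / 1"
    by (intro divide_left_mono) auto
  also have "\<dots> \<le> C * \<rho> ^ nat \<bar>n\<bar>" using assms by simp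
  finally show ?thesis by (simp add: norm_divide norm_mult)
qed (use order_trans[OF norm_ge_zero assms[of n]] in simp)

text \<open>Since \<open>\<theta>\<^sub>4\<close> solves a linear differential equation on the real line, a real zero would make it
  vanish on the whole line, contradicting that its mean value is \<open>1\<close>.\<close>

lemma theta4_real_ne_0:
  assumes p: "0 < norm p" "norm p < 1"
  shows "theta4 (of_real x) p \<noteq> 0"
proof
  assume zero: "theta4 (of_real x) p = 0"
  have lam: "norm (lambert p n) \<le> (1 / (1 - norm p)) * norm p ^ nat \<bar>n\<bar>" for n
    using norm_lambert_le[OF p, of n] by simp
  \<comment> \<open>An antiderivative of the Lambert series; nothing is lost at n = 0 because
    \<open>lambert p 0 = 0\<close>.\<close>
  define L where "L = fourier_series (\<lambda>n. lambert p n / (2 * \<i> * of_int n))"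
  have L: "(L has_field_derivative fourier_series (lambert p) (of_real t)) (at (of_real t))" for t
  proof -
    have "(\<lambda>n. 2 * \<i> * of_int n * (lambert p n / (2 * \<i> * of_int n))) = lambert p"
    proof
      show "2 * \<i> * of_int n * (lambert p n / (2 * \<i> * of_int n)) = lambert p n" for n
        by (cases "n = 0") auto
    qed
    thus ?thesis
      using has_field_derivative_fourier_series[OF norm_divide_index_le[OF lam], of t] p
      unfolding L_def by simp
  qed
  \<comment> \<open>The exponential is the integrating factor of the equation, so \<open>F\<close>
    is constant on the real line; it vanishes at x, hence everywhere.\<close>
  define F where "F = (\<lambda>z. theta4 z p * exp (2 * \<i> * L z))"
  have "(F has_field_derivative 0) (at (of_real t))" for t
    unfolding F_def
    by (rule derivative_eq_intros has_field_derivative_theta4[OF p] L refl | simp)+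
  hence "((\<lambda>t. F (of_real t)) has_vector_derivative 0) (at t within UNIV)" for t
    by (rule has_vector_derivative_real_field)
  then obtain C where C: "\<And>t. F (of_real t) = C"
    using has_vector_derivative_zero_constant[of UNIV "\<lambda>t. F (of_real t)"] by auto
  have "C = 0" using C[of x] zero by (simp add: F_def)
  hence th0: "theta4 (of_real t) p = 0" for t :: real
    using C[of t] by (simp add: F_def)
  define c where "c = (\<lambda>n::int. (-1) powi n * p powi (n\<^sup>2))"
  \<comment> \<open>An antiderivative of \<open>theta4\<close>, where z integrates the constant term
    1. If \<open>theta4\<close> vanished on the real line, \<open>H\<close> would be constant there,
    but periodicity of the remaining terms makes H(\<pi>) - H(0) equal to \<pi>.\<close>
  define H where "H = (\<lambda>z. z + fourier_series (\<lambda>n. c n / (2 * \<i> * of_int n)) z)"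
  have "(H has_field_derivative 0) (at (of_real t))" for t
  proof -
    have "((\<lambda>n. c n * exp (2 * \<i> * of_int n * of_real t)) has_sum 0) UNIV"
      using has_sum_fourier_series_bounded(1)[OF norm_theta4_coeff_le[OF p], of t] p th0[of t]
      unfolding theta4_eq_fourier_series[THEN fun_cong] c_def by simp
    moreover have "((\<lambda>n::int. if n = 0 then - 1 else 0 :: complex) has_sum - 1) UNIV"
      by (rule has_sum_finite_neutralI[of "{0}"]) auto
    ultimately have "((\<lambda>n. c n * exp (2 * \<i> * of_int n * of_real t) + (if n = 0 then - 1 else 0)) has_sum (0 + - 1)) UNIV"
      by (rule has_sum_add)
    moreover have "c n * exp (2 * \<i> * of_int n * of_real t) + (if n = 0 then - 1 else 0) =
      2 * \<i> * of_int n * (c n / (2 * \<i> * of_int n)) * exp (2 * \<i> * of_int n * of_real t)" for n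
      by (cases "n = 0") (auto simp: c_def)
    ultimately have "fourier_series (\<lambda>n. 2 * \<i> * of_int n * (c n / (2 * \<i> * of_int n))) (of_real t) = - 1"
      unfolding fourier_series_def by (intro infsumI) simp
    moreover have "(fourier_series (\<lambda>n. c n / (2 * \<i> * of_int n)) has_field_derivative
        fourier_series (\<lambda>n. 2 * \<i> * of_int n * (c n / (2 * \<i> * of_int n))) (of_real t)) (at (of_real t))"
      by (rule has_field_derivative_fourier_series[where C = 1 and \<rho> = "norm p"])
        (use norm_divide_index_le[OF norm_theta4_coeff_le[OF p]] p in \<open>auto simp: c_def\<close>)
    ultimately show ?thesis unfolding H_def by (auto intro!: derivative_eq_intros)
  qed
  hence "((\<lambda>t. H (of_real t)) has_vector_derivative 0) (at t within UNIV)" for t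
    by (rule has_vector_derivative_real_field)
  then obtain C' where "\<And>t. H (of_real t) = C'"
    using has_vector_derivative_zero_constant[of UNIV "\<lambda>t. H (of_real t)"] by auto
  hence "H (of_real pi) = H (of_real 0)" by metis
  moreover have "exp (2 * \<i> * of_int n * of_real pi) = exp (2 * \<i> * of_int n * of_real 0)" for n
    using exp_2pi_1_int[of n] by (simp add: mult_ac)
  ultimately show False by (simp add: H_def fourier_series_def)
qed

text \<open>Oddness of \<open>lambert\<close> pairs the indices n and -n into sines, with constant
  (-2i)(2i) = 4. The term at n = 0 is 0.\<close>

lemma theta4_logderiv_sums:
  assumes p: "0 < norm p" "norm p < 1"
  shows "(\<lambda>n. 4 * (p ^ n / (1 - p ^ (2 * n))) * of_real (sin (2 * real n * x)))
    sums (theta4' (of_real x) p / theta4 (of_real x) p)"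
proof -
  have p0: "p \<noteq> 0" using p by auto
  have lam: "norm (lambert p n) \<le> (1 / (1 - norm p)) * norm p ^ nat \<bar>n\<bar>" for n
    using norm_lambert_le[OF p, of n] by simp
  let ?f = "\<lambda>n. lambert p n * exp (2 * \<i> * of_int n * of_real x)"
  have hs: "(?f has_sum fourier_series (lambert p) (of_real x)) UNIV"
    using has_sum_fourier_series_bounded(1)[OF lam] p by simp
  have sm: "?f summable_on A" for A
    by (rule summable_on_subset_banach[OF has_sum_imp_summable[OF hs] subset_UNIV])
  have "(\<lambda>n::nat. ?f (int n)) summable_on UNIV"
    using sm[of "range int"] summable_on_reindex[of int UNIV ?f] by (simp add: comp_def)
  then obtain a where a: "((\<lambda>n::nat. ?f (int n)) has_sum a) UNIV" unfolding summable_on_def ..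
  have "(\<lambda>n::nat. ?f (- int n)) summable_on UNIV"
    using sm[of "range (\<lambda>n. - int n)"] summable_on_reindex[of "\<lambda>n. - int n" UNIV ?f]
    by (simp add: comp_def inj_on_def)
  then obtain b where b: "((\<lambda>n::nat. ?f (- int n)) has_sum b) UNIV" unfolding summable_on_def ..
  have ab: "fourier_series (lambert p) (of_real x) = a + b"
    using has_sum_unique[OF hs has_sum_int_split[of ?f, OF a b]] by simp
  \<comment> \<open>The pairing counts the index 0 twice, which is harmless since
    \<open>lambert p 0 = 0\<close>.\<close>
  have "(\<lambda>n. ?f (int n) + ?f (- int n)) sums (a + b)"
    using has_sum_add[OF a b] by (rule has_sum_imp_sums)
  hence "(\<lambda>n. - 2 * \<i> * (?f (int n) + ?f (- int n))) sums (- 2 * \<i> * (a + b))"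
    by (rule sums_mult)
  moreover have "- 2 * \<i> * (?f (int n) + ?f (- int n)) =
      4 * (p ^ n / (1 - p ^ (2 * n))) * of_real (sin (2 * real n * x))" for n
  proof -
    define y l where "y = 2 * complex_of_nat n * of_real x" and "l = p ^ n / (1 - p ^ (2 * n))"
    have "of_real (sin (2 * real n * x)) = sin y"
      unfolding sin_of_real[symmetric] y_def by simp
    also have "\<dots> = (exp (\<i> * y) - exp (- (\<i> * y))) / (2 * \<i>)" by (rule sin_exp_eq)
    finally have s: "2 * \<i> * of_real (sin (2 * real n * x)) = exp (\<i> * y) - exp (- (\<i> * y))"
      by (simp add: field_simps)
    have e: "2 * \<i> * of_int (int n) * of_real x = \<i> * y" "2 * \<i> * of_int (- int n) * of_real x = - (\<i> * y)"
      by (simp_all add: y_def)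
    have "?f (int n) + ?f (- int n) = l * (exp (\<i> * y) - exp (- (\<i> * y)))"
      unfolding e lambert_minus lambert_nat[OF p0] l_def by (simp only: right_diff_distrib) simp
    also have "\<dots> = l * (2 * \<i> * of_real (sin (2 * real n * x)))" by (simp only: s)
    finally have "- 2 * \<i> * (?f (int n) + ?f (- int n)) = - 2 * \<i> * (l * (2 * \<i> * of_real (sin (2 * real n * x))))"
      by (simp only:)
    also have "\<dots> = - 4 * (\<i> * \<i>) * l * of_real (sin (2 * real n * x))" by (simp only: mult_ac) simp
    finally show ?thesis unfolding l_def by simp
  qed
  moreover have "theta4' (of_real x) p / theta4 (of_real x) p = - 2 * \<i> * (a + b)"
    using DERIV_imp_deriv[OF has_field_derivative_theta4[OF p, of x]] theta4_real_ne_0[OF p, of x]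
    by (simp add: theta4'_def ab)
  ultimately show ?thesis by simp
qed

section \<open>Chebyshev expansions\<close>

lemma absolutely_integrable_on_iff_integrable:
  fixes f :: "real \<Rightarrow> 'a::euclidean_space"
  assumes "S \<in> sets lebesgue"
  shows "f absolutely_integrable_on S \<longleftrightarrow> integrable (lebesgue_on S) f"
  using assms by (simp add: integrable_restrict_space set_integrable_def)

text \<open>Change of variables along the injective map cos on [0,\<pi>], where |-sin \<phi>| = sin
  \<phi>. The equality of integrals is unconditional because both are 0 by convention when
  integrability fails.\<close>

lemma
  fixes f :: "real \<Rightarrow> 'a::euclidean_space"
  shows integrable_cos_substitution: "integrable (lebesgue_on {0..pi}) (\<lambda>\<phi>. sin \<phi> *\<^sub>R f (cos \<phi>)) \<longleftrightarrow>
      integrable (lebesgue_on {-1..1}) f" (is "?L \<longleftrightarrow> ?R")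
    and integral_cos_substitution: "(LINT \<phi>|lebesgue_on {0..pi}. sin \<phi> *\<^sub>R f (cos \<phi>)) =
      (LINT x|lebesgue_on {-1..1}. f x)"
proof -
  have img: "cos ` {0..pi} = {-1..1}"
  proof (intro equalityI subsetI)
    fix x :: real assume "x \<in> {-1..1}"
    thus "x \<in> cos ` {0..pi}"
      by (intro image_eqI[of _ _ "arccos x"]) (auto simp: arccos_lbound arccos_ubound)
  qed auto
  have sin: "\<bar>- sin \<phi>\<bar> = sin \<phi>" if "\<phi> \<in> {0..pi}" for \<phi> using that by (simp add: sin_ge_zero)
  have main: "(\<lambda>x. \<bar>- sin x\<bar> *\<^sub>R f (cos x)) absolutely_integrable_on {0..pi} \<and>
        integral {0..pi} (\<lambda>x. \<bar>- sin x\<bar> *\<^sub>R f (cos x)) = b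
      \<longleftrightarrow> f absolutely_integrable_on {-1..1} \<and> integral {-1..1} f = b" for b
    unfolding img[symmetric]
  proof (rule has_absolute_integral_change_of_variables_real[where g = cos and h = "\<lambda>x. - sin x"])
    show "(cos has_field_derivative - sin x) (at x within {0..pi})" for x :: real
      by (auto intro!: derivative_eq_intros)
    show "inj_on cos {0..pi}" by (rule inj_onI) (auto intro: cos_inj_pi)
  qed simp
  have cg: "integrable (lebesgue_on {0..pi}) (\<lambda>x. \<bar>- sin x\<bar> *\<^sub>R f (cos x)) \<longleftrightarrow> ?L"
    by (intro Bochner_Integration.integrable_cong refl) (use sin in simp)
  show iff: "?L \<longleftrightarrow> ?R"
    using main cg by (auto simp: absolutely_integrable_on_iff_integrable)
  show "(LINT \<phi>|lebesgue_on {0..pi}. sin \<phi> *\<^sub>R f (cos \<phi>)) = (LINT x|lebesgue_on {-1..1}. f x)"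
  proof (cases ?R)
    case True
    have "integral {0..pi} (\<lambda>x. \<bar>- sin x\<bar> *\<^sub>R f (cos x)) = integral {-1..1} f"
      using main True by (auto simp: absolutely_integrable_on_iff_integrable)
    moreover have "integral {0..pi} (\<lambda>x. \<bar>- sin x\<bar> *\<^sub>R f (cos x)) = integral {0..pi} (\<lambda>\<phi>. sin \<phi> *\<^sub>R f (cos \<phi>))"
      by (intro Henstock_Kurzweil_Integration.integral_cong) (simp only: sin)
    ultimately show ?thesis using True iff by (simp add: lebesgue_integral_eq_integral)
  qed (use iff in \<open>simp add: not_integrable_integral_eq\<close>)
qed

lemma wT_cos: "0 < \<phi> \<Longrightarrow> \<phi> < pi \<Longrightarrow> sin \<phi> * wT (cos \<phi>) = 1"
  using sin_gt_zero[of \<phi>] by (simp add: wT_def sin_squared_eq[symmetric])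

lemma wU_cos: "0 \<le> \<phi> \<Longrightarrow> \<phi> \<le> pi \<Longrightarrow> wU (cos \<phi>) = sin \<phi>"
  by (simp add: wU_def sin_squared_eq[symmetric] sin_ge_zero)

text \<open>The Jacobian sin \<phi> cancels \<open>wT\<close> on the open interval, and the two
  endpoints form a null set.\<close>

lemma
  fixes f :: "real \<Rightarrow> real"
  shows integrable_wT_iff: "integrable (lebesgue_on {-1..1}) (\<lambda>x. f x * wT x) \<longleftrightarrow>
      integrable (lebesgue_on {0..pi}) (\<lambda>\<phi>. f (cos \<phi>))"
    and integral_wT: "(LINT x|lebesgue_on {-1..1}. f x * wT x) = (LINT \<phi>|lebesgue_on {0..pi}. f (cos \<phi>))"
proof -
  have eq: "sin \<phi> *\<^sub>R (f (cos \<phi>) * wT (cos \<phi>)) = f (cos \<phi>)"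
    if "\<phi> \<in> space (lebesgue_on {0..pi})" "\<phi> \<notin> {0, pi}" for \<phi>
    using that wT_cos[of \<phi>] by (auto simp: mult_ac)
  have X: "countable {0, pi}" "\<And>\<phi>. \<phi> \<in> {0, pi} \<Longrightarrow> emeasure (lebesgue_on {0..pi}) {\<phi>} = 0"
    "\<And>\<phi>. \<phi> \<in> {0, pi} \<Longrightarrow> {\<phi>} \<in> sets (lebesgue_on {0..pi})"
    by (auto simp: emeasure_restrict_space sets_restrict_space_iff)
  show "integrable (lebesgue_on {-1..1}) (\<lambda>x. f x * wT x) \<longleftrightarrow>
      integrable (lebesgue_on {0..pi}) (\<lambda>\<phi>. f (cos \<phi>))"
    unfolding integrable_cos_substitution[symmetric]
    by (rule integrable_discrete_difference[OF X eq])
  show "(LINT x|lebesgue_on {-1..1}. f x * wT x) = (LINT \<phi>|lebesgue_on {0..pi}. f (cos \<phi>))"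
    unfolding integral_cos_substitution[symmetric]
    by (rule integral_discrete_difference[OF X eq])
qed

lemma integrable_wT: "integrable (lebesgue_on {-1..1}) wT"
  using integrable_wT_iff[of "\<lambda>_. 1"] by (simp add: continuous_imp_integrable_real)

section \<open>Orthogonality of the Chebyshev polynomials\<close>

lemma continuous_on_cheb_T [continuous_intros]: "continuous_on S (cheb_T n)"
  by (induction n rule: induct_nat_012) (auto intro!: continuous_intros)

lemma continuous_on_cheb_U [continuous_intros]: "continuous_on S (cheb_U n)"
  by (induction n rule: induct_nat_012) (auto intro!: continuous_intros)

lemma continuous_on_wU [continuous_intros]: "continuous_on S wU"
  unfolding wU_def by (intro continuous_intros)

lemma abs_cheb_T_le_1:
  assumes "\<bar>x\<bar> \<le> 1"
  shows "\<bar>cheb_T n x\<bar> \<le> 1"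
  using cheb_T_cos[of n "arccos x"] assms by (simp add: cos_arccos_abs)

lemma integral_cos_nat:
  "(LINT \<phi>|lebesgue_on {0..pi}. cos (of_int k * \<phi>)) = (if k = 0 then pi else 0)"
proof (cases "k = 0")
  case False
  have "((\<lambda>\<phi>. cos (of_int k * \<phi>)) has_integral (sin (of_int k * pi) / of_int k - sin (of_int k * 0) / of_int k)) {0..pi}"
    using False
    by (intro fundamental_theorem_of_calculus)
      (auto intro!: derivative_eq_intros simp flip: has_real_derivative_iff_has_vector_derivative)
  moreover have "sin (of_int k * pi) = 0" unfolding sin_zero_iff_int2 by blast
  ultimately have "integral {0..pi} (\<lambda>\<phi>. cos (of_int k * \<phi>)) = 0"
    by (intro integral_unique) simp
  thus ?thesis
    using False by (subst lebesgue_integral_eq_integral)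
      (auto intro!: continuous_imp_integrable_real continuous_intros)
qed (simp add: measure_restrict_space)

text \<open>The product of cosines splits into the frequencies n - m and n + m. Since m \<ge> 1, the
  second is nonzero, and the first contributes exactly when n = m.\<close>

lemma integral_cheb_T_cheb_T_wT:
  assumes "m \<ge> 1"
  shows "(LINT x|lebesgue_on {-1..1}. cheb_T n x * cheb_T m x * wT x) = (if n = m then pi / 2 else 0)"
proof -
  have "(LINT x|lebesgue_on {-1..1}. cheb_T n x * cheb_T m x * wT x) =
      (LINT \<phi>|lebesgue_on {0..pi}. (cos (of_int (int n - int m) * \<phi>) + cos (of_int (int n + int m) * \<phi>)) / 2)"
    unfolding integral_wT[of "\<lambda>x. cheb_T n x * cheb_T m x"] cheb_T_cos
    by (simp add: cos_times_cos left_diff_distrib distrib_right)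
  also have "\<dots> = (if n = m then pi / 2 else 0)"
    using assms by (subst integral_divide_zero, subst Bochner_Integration.integral_add)
      (auto simp: integral_cos_nat intro!: continuous_imp_integrable_real continuous_intros simp del: of_int_diff of_int_add)
  finally show ?thesis .
qed

text \<open>The Jacobian and the weight supply one sine each, turning the integrand into
  sin((n+1)\<phi>) sin((m+1)\<phi>). The sum frequency n + m + 2 is never 0, so no index is
  exceptional.\<close>

lemma integral_cheb_U_cheb_U_wU:
  "(LINT x|lebesgue_on {-1..1}. cheb_U n x * cheb_U m x * wU x) = (if n = m then pi / 2 else 0)"
proof -
  have "(LINT x|lebesgue_on {-1..1}. cheb_U n x * cheb_U m x * wU x) =
      (LINT \<phi>|lebesgue_on {0..pi}. (cos (of_int (int n - int m) * \<phi>) - cos (of_int (int n + int m + 2) * \<phi>)) / 2)"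
    unfolding integral_cos_substitution[symmetric]
  proof (rule Bochner_Integration.integral_cong[OF refl])
    fix \<phi> assume "\<phi> \<in> space (lebesgue_on {0..pi})"
    hence "sin \<phi> *\<^sub>R (cheb_U n (cos \<phi>) * cheb_U m (cos \<phi>) * wU (cos \<phi>)) =
        (cheb_U n (cos \<phi>) * sin \<phi>) * (cheb_U m (cos \<phi>) * sin \<phi>)"
      by (simp add: wU_cos mult_ac)
    thus "sin \<phi> *\<^sub>R (cheb_U n (cos \<phi>) * cheb_U m (cos \<phi>) * wU (cos \<phi>)) =
        (cos (of_int (int n - int m) * \<phi>) - cos (of_int (int n + int m + 2) * \<phi>)) / 2"
      unfolding cheb_U_cos_sin by (simp add: sin_times_sin left_diff_distrib distrib_right add_ac)
  qed
  also have "\<dots> = (if n = m then pi / 2 else 0)"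
    by (subst integral_divide_zero, subst Bochner_Integration.integral_diff)
      (auto simp: integral_cos_nat intro!: continuous_imp_integrable_real continuous_intros simp del: of_int_diff of_int_add)
  finally show ?thesis .
qed

section \<open>Bessel's inequality and completeness of the polynomials
  \<open>cheb_U n\<close>\<close>

lemma integrable_mult_continuous:
  fixes f h :: "real \<Rightarrow> 'a::{euclidean_space, real_normed_field}"
  assumes f: "integrable (lebesgue_on {a..b}) f" and h: "continuous_on {a..b} h"
  shows "integrable (lebesgue_on {a..b}) (\<lambda>x. f x * h x)"
proof -
  have "bounded (h ` {a..b})" using h compact_continuous_image compact_imp_bounded by blast
  then obtain B where B: "\<And>x. x \<in> {a..b} \<Longrightarrow> norm (h x) \<le> B" unfolding bounded_iff by blast
  have [measurable]: "f \<in> borel_measurable (lebesgue_on {a..b})" "h \<in> borel_measurable (lebesgue_on {a..b})"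
    using f h by (auto intro: continuous_imp_measurable_on_sets_lebesgue)
  show ?thesis
  proof (rule Bochner_Integration.integrable_bound)
    show "integrable (lebesgue_on {a..b}) (\<lambda>x. B * norm (f x))" using f by simp
    show "AE x in lebesgue_on {a..b}. norm (f x * h x) \<le> norm (B * norm (f x))"
    proof (rule AE_I2)
      fix x assume "x \<in> space (lebesgue_on {a..b})"
      hence "norm (h x) \<le> \<bar>B\<bar>" using B[of x] by auto
      thus "norm (f x * h x) \<le> norm (B * norm (f x))"
        by (simp add: norm_mult abs_mult mult.commute[of "norm (f x)"] mult_right_mono)
    qed
  qed measurable
qed

text \<open>Away from the endpoints \<open>wU\<close> and \<open>wT\<close> are reciprocal, so the
  inequality of arithmetic and geometric means bounds 2|g| by |g|^2 \<open>wU\<close> +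
  \<open>wT\<close>, and \<open>wT\<close> is integrable.\<close>

lemma L2_weight_wU_imp_integrable:
  assumes "g \<in> L2_weight wU"
  shows "integrable (lebesgue_on {-1..1}) g"
proof (rule Bochner_Integration.integrable_bound)
  have [measurable]: "g \<in> borel_measurable (lebesgue_on {-1..1})"
    and i: "integrable (lebesgue_on {-1..1}) (\<lambda>x. (norm (g x))\<^sup>2 * wU x)"
    using assms by (auto simp: L2_weight_def)
  show "g \<in> borel_measurable (lebesgue_on {-1..1})" by measurable
  show "integrable (lebesgue_on {-1..1}) (\<lambda>x. (norm (g x))\<^sup>2 * wU x + wT x)"
    using i integrable_wT by simp
  have "{-1, 1} \<in> null_sets (lebesgue_on {-1..1 :: real})"
    by (subst null_sets_restrict_space) auto
  thus "AE x in lebesgue_on {-1..1}. norm (g x) \<le> norm ((norm (g x))\<^sup>2 * wU x + wT x)"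
  proof (rule AE_I', intro subsetI)
    fix x assume "x \<in> {x \<in> space (lebesgue_on {-1..1}). \<not> norm (g x) \<le> norm ((norm (g x))\<^sup>2 * wU x + wT x)}"
    hence x: "x \<in> {-1..1}" and n: "\<not> norm (g x) \<le> norm ((norm (g x))\<^sup>2 * wU x + wT x)" by auto
    show "x \<in> {-1, 1}"
    proof (rule ccontr)
      assume "x \<notin> {-1, 1}"
      with x have "\<bar>x\<bar> < 1" by auto
      hence "x\<^sup>2 < 1" by (simp add: abs_square_less_1)
      define w where "w = sqrt (1 - x\<^sup>2)"
      have w: "w > 0" "wU x = w" "wT x = 1 / w" using \<open>x\<^sup>2 < 1\<close> by (auto simp: w_def wU_def wT_def)
      have "0 \<le> (norm (g x) * w - 1)\<^sup>2 / w" using w by simp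
      also have "\<dots> = (norm (g x))\<^sup>2 * w + 1 / w - 2 * norm (g x)"
        using w by (simp add: power2_eq_square field_simps)
      finally have "2 * norm (g x) \<le> (norm (g x))\<^sup>2 * wU x + wT x" using w by simp
      hence "norm (g x) \<le> (norm (g x))\<^sup>2 * wU x + wT x" using norm_ge_zero[of "g x"] by linarith
      thus False using n by auto
    qed
  qed
qed

lemma integrable_mult_cheb_U:
  assumes "integrable (lebesgue_on {-1..1}) f"
  shows "integrable (lebesgue_on {-1..1}) (\<lambda>x. f x * complex_of_real (cheb_U n x * wU x))"
  using assms by (intro integrable_mult_continuous continuous_intros)

lemma coeff_U_eq:
  "(LINT x|lebesgue_on {-1..1}. f x * of_real (cheb_U n x * wU x)) = of_real (pi / 2) * coeff_U f n"
  by (simp add: coeff_U_def)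

text \<open>With P the partial sum of the expansion, the integral of |g - P|^2 \<open>wU\<close> is
  nonnegative. By orthogonality both the pairing of g with P and that of P with itself equal \<pi>/2
  times the sum of the |c_k|^2.\<close>

lemma bessel_inequality:
  assumes g: "g \<in> L2_weight wU"
  shows "(\<Sum>k<N. (norm (coeff_U g k))\<^sup>2) \<le> 2 / pi * (LINT x|lebesgue_on {-1..1}. (norm (g x))\<^sup>2 * wU x)"
proof -
  let ?M = "lebesgue_on {-1..1 :: real}"
  define c where "c = coeff_U g"
  define P where "P = (\<lambda>x. \<Sum>k<N. c k * of_real (cheb_U k x))"
  have gi: "integrable ?M g" by (rule L2_weight_wU_imp_integrable[OF g])
  have g2: "integrable ?M (\<lambda>x. (norm (g x))\<^sup>2 * wU x)" using g by (simp add: L2_weight_def)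
  have cP: "continuous_on {-1..1} P" unfolding P_def by (intro continuous_intros)
  have Pi: "integrable ?M P" by (rule continuous_imp_integrable_real[OF cP])
  \<comment> \<open>Kept general in f because it serves for f = g, the cross term, and for f = P,
    the square term.\<close>
  have J: "integrable ?M (\<lambda>x. f x * cnj (P x) * of_real (wU x))"
    "(LINT x|?M. f x * cnj (P x) * of_real (wU x)) = (\<Sum>k<N. cnj (c k) * (LINT x|?M. f x * of_real (cheb_U k x * wU x)))"
    if f: "integrable ?M f" for f
  proof -
    have eq: "f x * cnj (P x) * of_real (wU x) = (\<Sum>k<N. cnj (c k) * (f x * of_real (cheb_U k x * wU x)))" for x
      by (simp add: P_def sum_distrib_left sum_distrib_right mult_ac)
    note i = integrable_mult_cheb_U[OF f]
    show "integrable ?M (\<lambda>x. f x * cnj (P x) * of_real (wU x))"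
      unfolding eq by (intro Bochner_Integration.integrable_sum integrable_mult_right i)
    show "(LINT x|?M. f x * cnj (P x) * of_real (wU x)) = (\<Sum>k<N. cnj (c k) * (LINT x|?M. f x * of_real (cheb_U k x * wU x)))"
      unfolding eq
      by (subst Bochner_Integration.integral_sum) (simp_all only: integral_mult_right_zero integrable_mult_right i)
  qed
  have PU: "(LINT x|?M. P x * of_real (cheb_U k x * wU x)) = of_real (pi / 2) * c k" if "k < N" for k
  proof -
    have i: "integrable ?M (\<lambda>x. cheb_U j x * cheb_U k x * wU x)" for j
      by (intro continuous_imp_integrable_real continuous_intros)
    have "P x * of_real (cheb_U k x * wU x) = (\<Sum>j<N. c j * of_real (cheb_U j x * cheb_U k x * wU x))" for x
      unfolding P_def sum_distrib_right by (simp add: mult_ac)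
    hence "(LINT x|?M. P x * of_real (cheb_U k x * wU x)) =
        (LINT x|?M. (\<Sum>j<N. c j * of_real (cheb_U j x * cheb_U k x * wU x)))"
      by (simp only:)
    also have "\<dots> = (\<Sum>j<N. c j * of_real (LINT x|?M. cheb_U j x * cheb_U k x * wU x))"
      using i by (subst Bochner_Integration.integral_sum) (simp_all only: integrable_mult_right integrable_of_real integral_mult_right_zero integral_complex_of_real)
    also have "\<dots> = (\<Sum>j<N. if j = k then of_real (pi / 2) * c k else 0)"
      unfolding integral_cheb_U_cheb_U_wU by (intro sum.cong) auto
    also have "\<dots> = of_real (pi / 2) * c k" using that by simp
    finally show ?thesis .
  qed
  have S: "(\<Sum>k<N. cnj (c k) * (of_real (pi / 2) * c k)) = of_real (pi / 2 * (\<Sum>k<N. (norm (c k))\<^sup>2))"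
    by (simp add: sum_distrib_left complex_norm_square mult_ac del: of_real_power)
  have "(LINT x|?M. g x * cnj (P x) * of_real (wU x)) = of_real (pi / 2 * (\<Sum>k<N. (norm (c k))\<^sup>2))"
    unfolding J(2)[OF gi] coeff_U_eq c_def[symmetric] S ..
  moreover have PP: "(LINT x|?M. P x * cnj (P x) * of_real (wU x)) = of_real (pi / 2 * (\<Sum>k<N. (norm (c k))\<^sup>2))"
    unfolding J(2)[OF Pi] S[symmetric] by (intro sum.cong) (simp_all only: PU lessThan_iff)
  ultimately have R: "(LINT x|?M. Re (g x * cnj (P x) * of_real (wU x))) = pi / 2 * (\<Sum>k<N. (norm (c k))\<^sup>2)"
    "(LINT x|?M. Re (P x * cnj (P x) * of_real (wU x))) = pi / 2 * (\<Sum>k<N. (norm (c k))\<^sup>2)"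
    using integral_Re[OF J(1)[OF gi]] integral_Re[OF J(1)[OF Pi]] by (simp_all only: Re_complex_of_real)
  have "0 \<le> (LINT x|?M. (norm (g x))\<^sup>2 * wU x - 2 * Re (g x * cnj (P x) * of_real (wU x)) + Re (P x * cnj (P x) * of_real (wU x)))"
  proof (rule integral_nonneg_AE, rule AE_I2)
    fix x assume "x \<in> space ?M"
    hence "wU x \<ge> 0" by (auto simp: wU_def abs_square_le_1)
    have "(norm (g x))\<^sup>2 * wU x - 2 * Re (g x * cnj (P x) * of_real (wU x)) + Re (P x * cnj (P x) * of_real (wU x))
      = (norm (g x - P x))\<^sup>2 * wU x"
      unfolding cmod_power2 by (simp add: algebra_simps power2_eq_square)
    also have "\<dots> \<ge> 0" using \<open>wU x \<ge> 0\<close> by simp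
    finally show "0 \<le> (norm (g x))\<^sup>2 * wU x - 2 * Re (g x * cnj (P x) * of_real (wU x)) + Re (P x * cnj (P x) * of_real (wU x))" .
  qed
  also have "\<dots> = (LINT x|?M. (norm (g x))\<^sup>2 * wU x) - 2 * (pi / 2 * (\<Sum>k<N. (norm (c k))\<^sup>2)) + pi / 2 * (\<Sum>k<N. (norm (c k))\<^sup>2)"
    using g2 integrable_Re[OF J(1)[OF gi]] integrable_Re[OF J(1)[OF Pi]]
    by (simp only: Bochner_Integration.integral_add Bochner_Integration.integral_diff
        Bochner_Integration.integrable_diff integrable_mult_right integral_mult_right_zero R)
  finally have "pi / 2 * (\<Sum>k<N. (norm (c k))\<^sup>2) \<le> (LINT x|?M. (norm (g x))\<^sup>2 * wU x)" by simp
  thus ?thesis by (simp add: c_def field_simps)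
qed

lemma summable_coeff_U:
  assumes "g \<in> L2_weight wU"
  shows "summable (\<lambda>k. (norm (coeff_U g k))\<^sup>2)"
  by (rule summableI_nonneg_bounded[OF _ bessel_inequality[OF assms]]) simp

lemma bounded_coeff_U:
  assumes "g \<in> L2_weight wU"
  obtains B where "\<And>k. norm (coeff_U g k) \<le> B"
proof -
  have "(\<lambda>k. (norm (coeff_U g k))\<^sup>2) \<longlonglongrightarrow> 0"
    by (rule summable_LIMSEQ_zero[OF summable_coeff_U[OF assms]])
  hence "(\<lambda>k. norm (coeff_U g k)) \<longlonglongrightarrow> 0" by (simp add: power_tendsto_0_iff)
  hence "Bseq (\<lambda>k. norm (coeff_U g k))" by (intro convergent_imp_Bseq) (auto simp: convergent_def)
  thus ?thesis using that by (auto simp: Bseq_def)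
qed

text \<open>The integrals of \<open>D\<close> against continuous approximations of \<open>sgn D\<close> converge to that of \<open>\<bar>D\<bar>\<close>.\<close>

lemma AE_eq_0_if_continuous_integrals_0:
  fixes D :: "real \<Rightarrow> real"
  assumes D: "integrable (lebesgue_on {a..b}) D"
    and ortho: "\<And>h. continuous_on {a..b} h \<Longrightarrow> (LINT x|lebesgue_on {a..b}. D x * h x) = 0"
  shows "AE x in lebesgue_on {a..b}. D x = 0"
proof -
  let ?M = "lebesgue_on {a..b}"
  define u where "u = (\<lambda>x. if x \<in> {a..b} then sgn (D x) else 0)"
  have [measurable]: "D \<in> borel_measurable ?M" using D by auto
  have "(\<lambda>x. sgn (D x)) \<in> borel_measurable ?M" by measurable
  hence "u \<in> borel_measurable lebesgue"
    unfolding u_def by (rule borel_measurable_if_I) simp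
  \<comment> \<open>This notion of measurability provides continuous functions converging to u
    outside a negligible set.\<close>
  hence "u measurable_on UNIV" by (rule lebesgue_measurable_imp_measurable_on_real) simp
  then obtain N k where N: "negligible N" and k: "\<And>n::nat. continuous_on UNIV (k n)"
    and lim: "\<And>x. x \<notin> N \<Longrightarrow> (\<lambda>n. k n x) \<longlonglongrightarrow> u x"
    unfolding measurable_on_def by auto
  \<comment> \<open>Clamping to [-1,1] yields the dominating function |D| and does not change the
    limit, as sgn D already lies in [-1,1].\<close>
  define h where "h = (\<lambda>n x. max (- 1) (min 1 (k n x)))"
  have hc: "continuous_on {a..b} (h n)" for n
    unfolding h_def by (intro continuous_intros continuous_on_subset[OF k]) auto
  have "(\<lambda>n. LINT x|?M. D x * h n x) \<longlonglongrightarrow> (LINT x|?M. D x * sgn (D x))"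
  proof (rule integral_dominated_convergence[where w = "\<lambda>x. \<bar>D x\<bar>"])
    show "(\<lambda>x. D x * sgn (D x)) \<in> borel_measurable ?M" by measurable
    show "(\<lambda>x. D x * h n x) \<in> borel_measurable ?M" for n
      using integrable_mult_continuous[OF D hc] by auto
    show "integrable ?M (\<lambda>x. \<bar>D x\<bar>)" using D by simp
    have "AE x in lebesgue. x \<notin> N"
      using N by (intro AE_not_in) (simp add: negligible_iff_null_sets)
    hence "AE x in ?M. x \<notin> N" by (subst AE_restrict_space_iff) auto
    moreover have "AE x in ?M. x \<in> {a..b}" by (rule AE_I2) simp
    ultimately show "AE x in ?M. (\<lambda>n. D x * h n x) \<longlonglongrightarrow> D x * sgn (D x)"
    proof eventually_elim
      case (elim x)
      have "(\<lambda>n. h n x) \<longlonglongrightarrow> max (- 1) (min 1 (u x))"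
        unfolding h_def using lim[OF elim(1)] by (intro tendsto_intros)
      also have "max (- 1) (min 1 (u x)) = sgn (D x)" using elim by (auto simp: u_def sgn_if)
      finally show ?case by (intro tendsto_intros)
    qed
    show "AE x in ?M. norm (D x * h n x) \<le> \<bar>D x\<bar>" for n
      by (rule AE_I2) (auto simp: abs_mult h_def intro!: mult_left_le)
  qed
  hence "(LINT x|?M. D x * sgn (D x)) = 0"
    unfolding ortho[OF hc] by (rule LIMSEQ_unique[OF _ tendsto_const])
  hence "(LINT x|?M. \<bar>D x\<bar>) = 0" by (simp add: abs_sgn)
  thus ?thesis using D by (subst (asm) integral_nonneg_eq_0_iff_AE) auto
qed

text \<open>By the Weierstrass theorem a continuous h is uniformly within e of a polynomial, which
  integrates to 0 against D. Hence the integral of D h is at most e times that of |D|, for every e >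
  0.\<close>

lemma AE_eq_0_if_moments_0:
  fixes D :: "real \<Rightarrow> real"
  assumes D: "integrable (lebesgue_on {a..b}) D"
    and mom: "\<And>n. (LINT x|lebesgue_on {a..b}. D x * x ^ n) = 0"
  shows "AE x in lebesgue_on {a..b}. D x = 0"
proof (rule AE_eq_0_if_continuous_integrals_0[OF D])
  let ?M = "lebesgue_on {a..b}"
  fix h :: "real \<Rightarrow> real" assume h: "continuous_on {a..b} h"
  define I where "I = (LINT x|?M. \<bar>D x\<bar>)"
  have "I \<ge> 0" by (simp add: I_def)
  have le: "\<bar>LINT x|?M. D x * h x\<bar> \<le> e * I" if "e > 0" for e
  proof -
    obtain p where p: "real_polynomial_function p" "\<And>x. x \<in> {a..b} \<Longrightarrow> \<bar>h x - p x\<bar> < e"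
      using Stone_Weierstrass_real_polynomial_function[OF compact_Icc h \<open>e > 0\<close>] by blast
    obtain c m where pc: "p = (\<lambda>x. \<Sum>i\<le>m. c i * x ^ i)"
      using p(1) unfolding real_polynomial_function_iff_sum by blast
    have ip: "integrable ?M (\<lambda>x. D x * x ^ i)" for i
      using D by (intro integrable_mult_continuous continuous_intros)
    have "D x * p x = (\<Sum>i\<le>m. c i * (D x * x ^ i))" for x
      by (simp add: pc sum_distrib_left mult_ac)
    hence "(LINT x|?M. D x * p x) = (\<Sum>i\<le>m. c i * (LINT x|?M. D x * x ^ i))"
      using ip by (simp add: Bochner_Integration.integral_sum)
    hence p0: "(LINT x|?M. D x * p x) = 0" by (simp add: mom)
    have cp: "continuous_on {a..b} p" unfolding pc by (intro continuous_intros)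
    have "(LINT x|?M. D x * h x) = (LINT x|?M. D x * h x) - (LINT x|?M. D x * p x)" by (simp add: p0)
    also have "\<dots> = (LINT x|?M. D x * (h x - p x))"
      using integrable_mult_continuous[OF D h] integrable_mult_continuous[OF D cp]
      by (simp add: right_diff_distrib)
    finally have "\<bar>LINT x|?M. D x * h x\<bar> \<le> (LINT x|?M. \<bar>D x * (h x - p x)\<bar>)"
      using integral_abs_bound by metis
    also have "\<dots> \<le> (LINT x|?M. e * \<bar>D x\<bar>)"
    proof (rule integral_mono)
      show "integrable ?M (\<lambda>x. \<bar>D x * (h x - p x)\<bar>)"
        using D h cp by (intro integrable_abs integrable_mult_continuous continuous_intros)
      show "integrable ?M (\<lambda>x. e * \<bar>D x\<bar>)" using D by simp
      show "\<bar>D x * (h x - p x)\<bar> \<le> e * \<bar>D x\<bar>" if "x \<in> space ?M" for x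
        using p(2)[of x] that by (simp add: abs_mult mult.commute[of "\<bar>D x\<bar>"] mult_right_mono)
    qed
    also have "\<dots> = e * I" by (simp add: I_def)
    finally show ?thesis .
  qed
  have "\<bar>LINT x|?M. D x * h x\<bar> \<le> 0 + e" if "e > 0" for e
  proof -
    \<comment> \<open>Dividing by I + 1 rather than I covers the case I = 0.\<close>
    have "e / (I + 1) * I \<le> e" using \<open>e > 0\<close> \<open>I \<ge> 0\<close> by (simp add: field_simps)
    thus ?thesis using le[of "e / (I + 1)"] \<open>e > 0\<close> \<open>I \<ge> 0\<close> by simp
  qed
  hence "\<bar>LINT x|?M. D x * h x\<bar> \<le> 0" by (rule field_le_epsilon)
  thus "(LINT x|?M. D x * h x) = 0" by simp
qed

text \<open>Reduction to moments: 2x U_n = U_(n+1) + U_(n-1), with 2x U_0 = U_1, trades one power of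
  x for a shift of the degree. The induction on the power therefore runs over all degrees at once,
  and degree 0 gives the moments.\<close>

lemma AE_eq_0_if_cheb_U_integrals_0:
  fixes D :: "real \<Rightarrow> real"
  assumes D: "integrable (lebesgue_on {-1..1}) D"
    and U: "\<And>n. (LINT x|lebesgue_on {-1..1}. D x * cheb_U n x) = 0"
  shows "AE x in lebesgue_on {-1..1}. D x = 0"
proof (rule AE_eq_0_if_moments_0[OF D])
  let ?M = "lebesgue_on {-1..1 :: real}"
  have i: "integrable ?M (\<lambda>x. D x * (x ^ j * cheb_U n x))" for j n
    using D by (intro integrable_mult_continuous continuous_intros)
  have "(LINT x|?M. D x * (x ^ j * cheb_U n x)) = 0" for j n
  proof (induction j arbitrary: n)
    case 0
    thus ?case by (simp add: U)
  next
    case (Suc j)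
    show ?case
    proof (cases n)
      case 0
      have "D x * (x ^ Suc j * cheb_U n x) = (D x * (x ^ j * cheb_U 1 x)) / 2" for x
        using 0 by simp
      thus ?thesis using Suc[of 1] by (simp only: integral_divide_zero)
    next
      case (Suc n')
      have "D x * (x ^ Suc j * cheb_U n x) =
          (D x * (x ^ j * cheb_U (Suc (Suc n')) x) + D x * (x ^ j * cheb_U n' x)) / 2" for x
        unfolding Suc by (simp add: algebra_simps)
      thus ?thesis
        using Suc.IH[of "Suc (Suc n')"] Suc.IH[of n'] i
        by (simp only: integral_divide_zero Bochner_Integration.integral_add) simp
    qed
  qed
  from this[of _ 0] show "(LINT x|?M. D x * x ^ n) = 0" for n by simp
qed

text \<open>The weight is absorbed into the difference D, whose real and imaginary parts are then
  orthogonal to all \<open>cheb_U n\<close> without weight. It can be divided out again because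
  \<open>wU\<close> vanishes on [-1,1] only at the endpoints.\<close>

lemma coeff_U_inj:
  assumes g: "g \<in> L2_weight wU" and h: "h \<in> L2_weight wU"
    and eq: "\<And>n. coeff_U g n = coeff_U h n"
  shows "AE x in lebesgue_on {-1..1}. g x = h x"
proof -
  let ?M = "lebesgue_on {-1..1 :: real}"
  define D where "D = (\<lambda>x. (g x - h x) * of_real (wU x))"
  note gi = L2_weight_wU_imp_integrable[OF g] and hi = L2_weight_wU_imp_integrable[OF h]
  have Di: "integrable ?M D"
    unfolding D_def using gi hi by (intro integrable_mult_continuous continuous_intros) auto
  have DU: "integrable ?M (\<lambda>x. D x * of_real (cheb_U n x))" for n
    using Di by (intro integrable_mult_continuous continuous_intros)
  have 0: "(LINT x|?M. D x * of_real (cheb_U n x)) = 0" for n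
  proof -
    have "(LINT x|?M. D x * of_real (cheb_U n x)) = (LINT x|?M. g x * of_real (cheb_U n x * wU x) - h x * of_real (cheb_U n x * wU x))"
      by (simp add: D_def algebra_simps)
    also have "\<dots> = 0"
      by (subst Bochner_Integration.integral_diff)
        (simp_all only: integrable_mult_cheb_U gi hi coeff_U_eq eq diff_self)
    finally show ?thesis .
  qed
  have "(LINT x|?M. Re (D x) * cheb_U n x) = 0" "(LINT x|?M. Im (D x) * cheb_U n x) = 0" for n
    using integral_Re[OF DU[of n]] integral_Im[OF DU[of n]] by (simp_all add: 0)
  hence "AE x in ?M. Re (D x) = 0" "AE x in ?M. Im (D x) = 0"
    using integrable_Re[OF Di] integrable_Im[OF Di] by (auto intro: AE_eq_0_if_cheb_U_integrals_0)
  moreover have "AE x in ?M. x \<notin> {-1, 1}"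
    by (rule AE_not_in) (subst null_sets_restrict_space, auto)
  moreover have "AE x in ?M. x \<in> {-1..1}" by (rule AE_I2) simp
  ultimately show ?thesis
  proof eventually_elim
    case (elim x)
    hence "\<bar>x\<bar> < 1" by auto
    hence "x\<^sup>2 < 1" by (simp add: abs_square_less_1)
    hence "wU x \<noteq> 0" by (simp add: wU_def)
    moreover have "D x = 0" using elim by (simp add: complex_eq_iff)
    ultimately show ?case by (simp add: D_def)
  qed
qed

section \<open>Rapidly convergent Chebyshev series\<close>

text \<open>Since |T_n| \<le> 1 on [-1,1], the geometric decay makes f bounded, and the majorants C
  \<rho>^n \<open>wT\<close> allow termwise integration. Orthogonality then isolates the m-th
  coefficient; index 0 has another normalization.\<close>

lemma
  fixes d :: "nat \<Rightarrow> complex"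
  assumes d: "\<And>n. norm (d n) \<le> C * \<rho> ^ n" "0 \<le> \<rho>" "\<rho> < 1"
    and f: "\<And>x. x \<in> {-1..1} \<Longrightarrow> f x = (\<Sum>n. d n * of_real (cheb_T n x))"
  shows chebyshev_series_L2_weight_wT: "f \<in> L2_weight wT"
    and coeff_T_chebyshev_series: "m \<ge> 1 \<Longrightarrow> coeff_T f m = d m"
proof -
  let ?M = "lebesgue_on {-1..1 :: real}"
  have bnd: "norm (d n * of_real (cheb_T n x)) \<le> C * \<rho> ^ n" if "x \<in> {-1..1}" for n x
  proof -
    have "norm (d n) * \<bar>cheb_T n x\<bar> \<le> norm (d n) * 1"
      using that by (intro mult_left_mono abs_cheb_T_le_1) auto
    thus ?thesis using d(1)[of n] by (simp add: norm_mult)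
  qed
  have geo: "summable (\<lambda>n. C * \<rho> ^ n)" using d by (intro summable_mult summable_geometric) auto
  have sm: "summable (\<lambda>n. norm (d n * of_real (cheb_T n x)))" if "x \<in> {-1..1}" for x
    by (rule summable_comparison_test'[OF geo]) (use bnd[OF that] in simp)
  define K where "K = (\<Sum>n. C * \<rho> ^ n)"
  have fK: "norm (f x) \<le> K" if "x \<in> {-1..1}" for x
  proof -
    have "norm (f x) \<le> (\<Sum>n. norm (d n * of_real (cheb_T n x)))"
      unfolding f[OF that] by (rule summable_norm[OF sm[OF that]])
    also have "\<dots> \<le> K" unfolding K_def by (rule suminf_le[OF bnd[OF that] sm[OF that] geo])
    finally show ?thesis .
  qed
  have [measurable]: "cheb_T n \<in> borel_measurable ?M" for n
    by (rule continuous_imp_measurable_on_sets_lebesgue) (auto intro: continuous_intros)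
  have [measurable]: "wT \<in> borel_measurable ?M" using integrable_wT by auto
  have "(\<lambda>x. \<Sum>n. d n * of_real (cheb_T n x)) \<in> borel_measurable ?M" by measurable
  moreover have "f \<in> borel_measurable ?M \<longleftrightarrow> (\<lambda>x. \<Sum>n. d n * of_real (cheb_T n x)) \<in> borel_measurable ?M"
    by (rule measurable_cong) (simp add: f)
  ultimately have [measurable]: "f \<in> borel_measurable ?M" by simp
  have wT: "0 \<le> wT x" if "x \<in> {-1..1}" for x
    using that by (auto simp: wT_def abs_square_le_1)
  have "integrable ?M (\<lambda>x. (norm (f x))\<^sup>2 * wT x)"
  proof (rule Bochner_Integration.integrable_bound)
    show "integrable ?M (\<lambda>x. K\<^sup>2 * wT x)" using integrable_wT by simp
    show "AE x in ?M. norm ((norm (f x))\<^sup>2 * wT x) \<le> norm (K\<^sup>2 * wT x)"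
    proof (rule AE_I2)
      fix x assume "x \<in> space ?M"
      hence x: "x \<in> {-1..1}" by simp
      have "(norm (f x))\<^sup>2 * wT x \<le> K\<^sup>2 * wT x"
        by (intro mult_right_mono power_mono fK wT x) simp
      thus "norm ((norm (f x))\<^sup>2 * wT x) \<le> norm (K\<^sup>2 * wT x)" using wT[OF x] by simp
    qed
  qed measurable
  thus "f \<in> L2_weight wT" by (simp add: L2_weight_def)
  assume m: "m \<ge> 1"
  let ?u = "\<lambda>n x. d n * of_real (cheb_T n x * cheb_T m x * wT x)"
  have ri: "integrable ?M (\<lambda>x. cheb_T n x * cheb_T m x * wT x)" for n
    using integrable_mult_continuous[OF integrable_wT continuous_on_mult[OF continuous_on_cheb_T continuous_on_cheb_T], of n m]
    by (simp add: mult_ac)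
  have ui: "integrable ?M (?u n)" for n using ri[of n] by (intro integrable_mult_right integrable_of_real)
  have ub: "norm (?u n x) \<le> C * \<rho> ^ n * wT x" if "x \<in> {-1..1}" for n x
  proof -
    have "norm (?u n x) = norm (d n * of_real (cheb_T n x)) * (\<bar>cheb_T m x\<bar> * wT x)"
      using wT[OF that] by (simp add: norm_mult abs_mult)
    also have "\<dots> \<le> (C * \<rho> ^ n) * (1 * wT x)"
    proof (rule mult_mono[OF bnd[OF that] mult_right_mono[OF abs_cheb_T_le_1 wT[OF that]]])
      show "0 \<le> C * \<rho> ^ n" using d(1)[of n] norm_ge_zero[of "d n"] by linarith
    qed (use that wT in auto)
    finally show ?thesis by simp
  qed
  have "(\<lambda>n. LINT x|?M. ?u n x) sums (LINT x|?M. (\<Sum>n. ?u n x))"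
  proof (rule sums_integral[OF ui])
    show "AE x in ?M. summable (\<lambda>n. norm (?u n x))"
    proof (rule AE_I2)
      fix x assume "x \<in> space ?M"
      hence x: "x \<in> {-1..1}" by simp
      show "summable (\<lambda>n. norm (?u n x))"
        by (rule summable_comparison_test'[OF summable_mult2[OF geo, of "wT x"]]) (use ub[OF x] in simp)
    qed
    show "summable (\<lambda>n. LINT x|?M. norm (?u n x))"
    proof (rule summable_comparison_test'[OF summable_mult2[OF geo, of "LINT x|?M. wT x"]])
      fix n
      have "(LINT x|?M. norm (?u n x)) \<le> (LINT x|?M. C * \<rho> ^ n * wT x)"
        by (intro integral_mono integrable_norm ui integrable_mult_right integrable_wT) (use ub in simp)
      thus "norm (LINT x|?M. norm (?u n x)) \<le> C * \<rho> ^ n * (LINT x|?M. wT x)"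
        by (simp add: integral_nonneg_AE)
    qed
  qed
  moreover have "(LINT x|?M. ?u n x) = (if n = m then of_real (pi / 2) * d m else 0)" for n
    unfolding integral_mult_right_zero integral_complex_of_real integral_cheb_T_cheb_T_wT[OF m] by simp
  moreover have "(LINT x|?M. (\<Sum>n. ?u n x)) = (LINT x|?M. f x * of_real (cheb_T m x * wT x))"
  proof (rule Bochner_Integration.integral_cong[OF refl])
    fix x assume "x \<in> space ?M"
    hence x: "x \<in> {-1..1}" by simp
    show "(\<Sum>n. ?u n x) = f x * of_real (cheb_T m x * wT x)"
      using suminf_mult2[OF summable_norm_cancel[OF sm[OF x]], of "of_real (cheb_T m x * wT x)"]
      by (simp add: f[OF x] mult_ac)
  qed
  ultimately have "(\<lambda>n. if n = m then of_real (pi / 2) * d m else 0) sums (LINT x|?M. f x * of_real (cheb_T m x * wT x))"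
    by simp
  hence "(LINT x|?M. f x * of_real (cheb_T m x * wT x)) = of_real (pi / 2) * d m"
    using sums_single[of m "\<lambda>_. of_real (pi / 2) * d m"] sums_unique2 by blast
  hence "coeff_T f m = of_real (2 / pi) * (of_real (pi / 2) * d m)"
    unfolding coeff_T_def using m by (simp only:) simp
  thus "coeff_T f m = d m" by simp
qed

section \<open>The inverse operator\<close>

lemma
  fixes f :: "real \<Rightarrow> 'a::euclidean_space"
  assumes "0 \<le> a" "integrable (lebesgue_on {0..a}) f" "integrable (lebesgue_on {0..a}) (\<lambda>x. f (- x))"
  shows integrable_symmetric_interval: "integrable (lebesgue_on {-a..a}) f"
    and integral_symmetric_interval:
      "(LINT x|lebesgue_on {-a..a}. f x) = (LINT x|lebesgue_on {0..a}. f x + f (- x))"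
proof -
  have neg: "integrable (lebesgue_on {-a..0}) f"
    using assms(3) integrable_reflect_real[of a 0 "\<lambda>x. f (- x)"] by simp
  show int: "integrable (lebesgue_on {-a..a}) f"
    using assms by (intro Equivalence_Measurable_On_Borel.integrable_combine[OF neg]) auto
  show "(LINT x|lebesgue_on {-a..a}. f x) = (LINT x|lebesgue_on {0..a}. f x + f (- x))"
    using Equivalence_Measurable_On_Borel.integral_combine[OF int, of 0] assms
      integral_reflect_real[of a 0 "\<lambda>x. f (- x)"]
    by (simp add: Bochner_Integration.integral_add)
qed

lemma integrable_cos_sin:
  assumes "integrable (lebesgue_on {-1..1}) g"
  shows "integrable (lebesgue_on {-pi..pi}) (\<lambda>\<phi>. g (cos \<phi>) * complex_of_real (sin \<phi>))"
proof -
  have "integrable (lebesgue_on {0..pi}) (\<lambda>\<phi>. g (cos \<phi>) * complex_of_real (sin \<phi>))"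
    using assms integrable_cos_substitution[of g] by (simp add: scaleR_conv_of_real mult.commute)
  thus ?thesis by (intro integrable_symmetric_interval) simp_all
qed

text \<open>As g(cos \<phi>) sin \<phi> is odd, folding to [0,\<pi>] leaves sin(n(\<theta>+\<phi>))
  - sin(n(\<theta>-\<phi>)) = 2 cos(n\<theta>) sin(n\<phi>). Here sin(n\<phi>) contains U_(n-1)(cos
  \<phi>) and a factor sin \<phi>; of the two sines one becomes \<open>wU\<close> and the other the
  Jacobian.\<close>

lemma integral_sin_cos_sin:
  assumes g: "g \<in> L2_weight wU" and n: "n \<ge> 1"
  shows "(LINT \<phi>|lebesgue_on {-pi..pi}. of_real (sin (real n * (\<theta> + \<phi>))) * (g (cos \<phi>) * of_real (sin \<phi>))) =
    of_real (pi * cos (real n * \<theta>)) * coeff_U g (n - 1)"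
proof -
  let ?M = "lebesgue_on {0..pi}"
  define G where "G = (\<lambda>\<phi>. g (cos \<phi>) * complex_of_real (sin \<phi>))"
  note gi = L2_weight_wU_imp_integrable[OF g]
  have Gi: "integrable ?M G"
    using gi integrable_cos_substitution[of g] by (simp add: G_def scaleR_conv_of_real mult.commute)
  have GH: "integrable ?M (\<lambda>\<phi>. complex_of_real (h \<phi>) * G \<phi>)" if "continuous_on {0..pi} h" for h
    using integrable_mult_continuous[OF Gi continuous_on_of_real[OF that]] by (simp add: mult.commute)
  have "(LINT \<phi>|lebesgue_on {-pi..pi}. of_real (sin (real n * (\<theta> + \<phi>))) * G \<phi>) =
      (LINT \<phi>|?M. of_real (sin (real n * (\<theta> + \<phi>))) * G \<phi> + of_real (sin (real n * (\<theta> + - \<phi>))) * G (- \<phi>))"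
  proof (rule integral_symmetric_interval)
    show "integrable ?M (\<lambda>\<phi>. of_real (sin (real n * (\<theta> + \<phi>))) * G \<phi>)"
      by (intro GH continuous_intros)
    have "integrable ?M (\<lambda>\<phi>. of_real (- sin (real n * (\<theta> + - \<phi>))) * G \<phi>)"
      by (intro GH continuous_intros)
    thus "integrable ?M (\<lambda>\<phi>. of_real (sin (real n * (\<theta> + - \<phi>))) * G (- \<phi>))"
      by (simp add: G_def)
  qed simp
  also have "\<dots> = (LINT \<phi>|?M. of_real (2 * cos (real n * \<theta>)) * (sin \<phi> *\<^sub>R (g (cos \<phi>) * of_real (cheb_U (n - 1) (cos \<phi>) * wU (cos \<phi>)))))"
  proof (rule Bochner_Integration.integral_cong[OF refl])
    fix \<phi> assume "\<phi> \<in> space ?M"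
    hence w: "wU (cos \<phi>) = sin \<phi>" by (simp add: wU_cos)
    have s: "cheb_U (n - 1) (cos \<phi>) * sin \<phi> = sin (real n * \<phi>)"
      using cheb_U_cos_sin[of "n - 1" \<phi>] n by simp
    have "sin (real n * (\<theta> + \<phi>)) - sin (real n * (\<theta> + - \<phi>)) = 2 * cos (real n * \<theta>) * sin (real n * \<phi>)"
      by (simp add: distrib_left right_diff_distrib sin_add sin_diff)
    hence "of_real (sin (real n * (\<theta> + \<phi>))) * G \<phi> + of_real (sin (real n * (\<theta> + - \<phi>))) * G (- \<phi>) =
        complex_of_real (2 * cos (real n * \<theta>) * sin (real n * \<phi>)) * G \<phi>"
      by (simp add: G_def left_diff_distrib[symmetric] flip: of_real_diff)
    thus "of_real (sin (real n * (\<theta> + \<phi>))) * G \<phi> + of_real (sin (real n * (\<theta> + - \<phi>))) * G (- \<phi>) =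
        of_real (2 * cos (real n * \<theta>)) * (sin \<phi> *\<^sub>R (g (cos \<phi>) * of_real (cheb_U (n - 1) (cos \<phi>) * wU (cos \<phi>))))"
      unfolding w s by (simp add: G_def scaleR_conv_of_real mult_ac)
  qed
  also have "\<dots> = of_real (2 * cos (real n * \<theta>)) * (of_real (pi / 2) * coeff_U g (n - 1))"
    unfolding integral_mult_right_zero
      integral_cos_substitution[of "\<lambda>x. g x * of_real (cheb_U (n - 1) x * wU x)"] coeff_U_eq ..
  finally show ?thesis by (simp add: G_def)
qed

text \<open>Termwise integration of the series for the logarithmic derivative. The nome r turns 1 -
  r^(2n) into 1 - q^n, and the half angle turns sin(2nz) into sin(n(\<theta>+\<phi>)). The factors 4
  and \<pi> cancel against the prefactor.\<close>

lemma q_inv_integral_sums: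
  assumes q: "0 < norm q" "norm q < 1" "r\<^sup>2 = q" and g: "g \<in> L2_weight wU"
  shows "(\<lambda>n. (1 - q) / r * (r ^ n / (1 - q ^ n)) * coeff_U g (n - 1) * of_real (cos (real n * \<theta>)))
    sums q_inv_integral q r g \<theta>"
proof -
  let ?M = "lebesgue_on {-pi..pi}"
  have r: "0 < norm r" "norm r < 1" "r \<noteq> 0"
    using q by (auto simp: norm_power power_less_one_iff)
  define G where "G = (\<lambda>\<phi>. g (cos \<phi>) * complex_of_real (sin \<phi>))"
  define t where "t n = r ^ n / (1 - q ^ n)" for n
  have rq: "r ^ (2 * n) = q ^ n" for n using q(3) by (simp add: power_mult)
  have Gi: "integrable ?M G"
    unfolding G_def by (rule integrable_cos_sin[OF L2_weight_wU_imp_integrable[OF g]])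
  \<comment> \<open>By \<open>rq\<close>, \<open>t n\<close> is the Lambert coefficient of the nome
    r.\<close>
  have tn: "norm (t n) \<le> 1 / (1 - norm r) * norm r ^ n" for n
    using norm_lambert_le[OF r(1,2), of "int n"] r by (simp add: lambert_nat rq t_def)
  let ?u = "\<lambda>n \<phi>. 4 * t n * (of_real (sin (real n * (\<theta> + \<phi>))) * G \<phi>)"
  have ui: "integrable ?M (?u n)" for n
  proof -
    have "continuous_on {-pi..pi} (\<lambda>\<phi>. complex_of_real (sin (real n * (\<theta> + \<phi>))))"
      by (intro continuous_intros)
    from integrable_mult_continuous[OF Gi this] show ?thesis
      by (intro integrable_mult_right) (simp add: mult.commute)
  qed
  have ub: "norm (?u n \<phi>) \<le> 4 / (1 - norm r) * norm r ^ n * norm (G \<phi>)" for n \<phi>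
  proof -
    have "norm (?u n \<phi>) = 4 * norm (t n) * (\<bar>sin (real n * (\<theta> + \<phi>))\<bar> * norm (G \<phi>))"
      by (simp add: norm_mult)
    also have "\<dots> \<le> 4 * (1 / (1 - norm r) * norm r ^ n) * (1 * norm (G \<phi>))"
      using tn[of n] r by (intro mult_mono mult_left_mono mult_right_mono) auto
    finally show ?thesis by simp
  qed
  have geo: "summable (\<lambda>n. 4 / (1 - norm r) * norm r ^ n)"
    using r by (intro summable_mult summable_geometric) auto
  have K: "theta4' (of_real ((\<theta> + \<phi>) / 2)) r / theta4 (of_real ((\<theta> + \<phi>) / 2)) r * g (cos \<phi>) * of_real (sin \<phi>) =
      (\<Sum>n. ?u n \<phi>)" for \<phi>
  proof -
    have arg: "2 * real n * ((\<theta> + \<phi>) / 2) = real n * (\<theta> + \<phi>)" for n by simp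
    from sums_mult2[OF theta4_logderiv_sums[OF r(1,2), of "(\<theta> + \<phi>) / 2"], of "G \<phi>"]
    show ?thesis unfolding rq t_def[symmetric] arg by (simp only: sums_iff G_def mult.assoc)
  qed
  have "(\<lambda>n. LINT \<phi>|?M. ?u n \<phi>) sums (LINT \<phi>|?M. (\<Sum>n. ?u n \<phi>))"
  proof (rule sums_integral[OF ui])
    show "AE \<phi> in ?M. summable (\<lambda>n. norm (?u n \<phi>))"
    proof (rule AE_I2)
      fix \<phi>
      show "summable (\<lambda>n. norm (?u n \<phi>))"
        by (rule summable_comparison_test'[OF summable_mult2[OF geo, of "norm (G \<phi>)"]]) (use ub[of _ \<phi>] in simp)
    qed
    show "summable (\<lambda>n. LINT \<phi>|?M. norm (?u n \<phi>))"
    proof (rule summable_comparison_test'[OF summable_mult2[OF geo, of "LINT \<phi>|?M. norm (G \<phi>)"]])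
      fix n
      have "(LINT \<phi>|?M. norm (?u n \<phi>)) \<le> (LINT \<phi>|?M. 4 / (1 - norm r) * norm r ^ n * norm (G \<phi>))"
        by (intro integral_mono integrable_norm ui integrable_mult_right Gi ub)
      thus "norm (LINT \<phi>|?M. norm (?u n \<phi>)) \<le> 4 / (1 - norm r) * norm r ^ n * (LINT \<phi>|?M. norm (G \<phi>))"
        by (simp add: integral_nonneg_AE)
    qed
  qed
  from sums_mult[OF this, of "(1 - q) / (4 * of_real pi * r)"]
  have "(\<lambda>n. (1 - q) / (4 * of_real pi * r) * (LINT \<phi>|?M. ?u n \<phi>)) sums q_inv_integral q r g \<theta>"
    unfolding q_inv_integral_def K .
  moreover have "(1 - q) / (4 * of_real pi * r) * (LINT \<phi>|?M. ?u n \<phi>) =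
      (1 - q) / r * (r ^ n / (1 - q ^ n)) * coeff_U g (n - 1) * of_real (cos (real n * \<theta>))" for n
  \<comment> \<open>At n = 0 the denominator 1 - q^n is 0, so both sides are 0 by convention and the
    truncated index \<open>n - 1\<close> has no effect.\<close>
  proof (cases "n = 0")
    case False
    have I: "(LINT \<phi>|?M. ?u n \<phi>) = 4 * t n * (of_real (pi * cos (real n * \<theta>)) * coeff_U g (n - 1))"
      unfolding integral_mult_right_zero G_def
      using False by (subst integral_sin_cos_sin[OF g]) simp_all
    show ?thesis unfolding I unfolding t_def by simp
  qed simp
  ultimately show ?thesis by simp
qed

theorem theorem2p1:
  fixes q r :: complex and g :: "real \<Rightarrow> complex"
  assumes "0 < norm q" and "norm q < 1" and "r\<^sup>2 = q"
    and "g \<in> L2_weight wU"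
  shows "q_differentiable q r (q_deriv_inv q r g) \<and>
    (AE x in lebesgue_on {-1..1}. q_deriv r (q_deriv_inv q r g) x = g x)"
proof -
  define f where "f = q_deriv_inv q r g"
  \<comment> \<open>The Chebyshev coefficients of f. Division by zero gives
    \<open>d 0 = 0\<close>.\<close>
  define d where "d n = (1 - q) / r * (r ^ n / (1 - q ^ n)) * coeff_U g (n - 1)" for n
  have r: "0 < norm r" "norm r < 1" "r \<noteq> 0"
    using assms by (auto simp: norm_power power_less_one_iff)
  have rq: "r ^ (2 * n) = q ^ n" for n using assms(3) by (simp add: power_mult)
  have qn: "q ^ n \<noteq> 1" if "n \<ge> 1" for n
  proof
    assume "q ^ n = 1"
    hence "norm q ^ n = 1" by (metis norm_one norm_power)
    moreover have "norm q ^ n < 1" using assms that by (simp add: power_less_one_iff)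
    ultimately show False by simp
  qed
  obtain B where B: "\<And>k. norm (coeff_U g k) \<le> B" using bounded_coeff_U[OF assms(4)] by blast
  \<comment> \<open>The decay comes from the Lambert factor alone; the coefficients of g only need
    to be bounded.\<close>
  have dn: "norm (d n) \<le> norm ((1 - q) / r) * (1 / (1 - norm r)) * B * norm r ^ n" for n
  proof -
    have "norm (r ^ n / (1 - q ^ n)) \<le> norm r ^ n / (1 - norm r)"
      using norm_lambert_le[OF r(1,2), of "int n"] r by (simp add: lambert_nat rq)
    hence "norm (d n) \<le> norm ((1 - q) / r) * (norm r ^ n / (1 - norm r)) * B"
      unfolding d_def norm_mult using r B by (intro mult_mono mult_left_mono mult_nonneg_nonneg) auto
    thus ?thesis by (simp add: mult_ac)
  qed
  have f: "f x = (\<Sum>n. d n * of_real (cheb_T n x))" if "x \<in> {-1..1}" for x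
  proof -
    have "cheb_T n x = cos (real n * arccos x)" for n
      using cheb_T_cos[of n "arccos x"] that by simp
    thus ?thesis
      using q_inv_integral_sums[OF assms, of "arccos x"]
      by (simp add: f_def q_deriv_inv_def d_def sums_iff)
  qed
  have L2: "f \<in> L2_weight wT"
    by (rule chebyshev_series_L2_weight_wT[OF dn _ r(2) f]) auto
  have coeff: "coeff_T f n = d n" if "n \<ge> 1" for n
    by (rule coeff_T_chebyshev_series[OF dn _ r(2) f that]) auto
  have "summable (\<lambda>n. (norm ((1 - q ^ n) * r powi (- int n) * coeff_T f n))\<^sup>2)"
  \<comment> \<open>After the term of index 0 is split off, the multiplier cancels r^n / (1 - q^n)
    and leaves a constant multiple of \<open>coeff_U g n\<close>, square summable by Bessel's
    inequality.\<close>
  proof (subst summable_Suc_iff[symmetric])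
    have "(1 - q ^ Suc n) * r powi (- int (Suc n)) * coeff_T f (Suc n) = (1 - q) / r * coeff_U g n" for n
    proof -
      have "r powi (- int (Suc n)) = 1 / r ^ Suc n"
        by (subst power_int_minus, subst power_int_of_nat) (simp add: divide_inverse)
      thus ?thesis using coeff[of "Suc n"] qn[of "Suc n"] r(3)
        by (simp add: d_def del: power_Suc)
    qed
    thus "summable (\<lambda>n. (norm ((1 - q ^ Suc n) * r powi (- int (Suc n)) * coeff_T f (Suc n)))\<^sup>2)"
      using summable_mult[OF summable_coeff_U[OF assms(4)], of "(norm ((1 - q) / r))\<^sup>2"]
      by (simp only: norm_mult power_mult_distrib)
  qed
  hence qd: "q_differentiable q r f" using L2 by (simp add: q_differentiable_def)
  let ?P = "\<lambda>h. h \<in> L2_weight wU \<and>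
     (\<forall>n\<ge>1. coeff_U h (n - 1) = (r ^ n - r powi (- int n)) / (r - r powi (-1)) * coeff_T f n)"
  have factor: "(r ^ n - r powi (- int n)) / (r - r powi (-1)) * coeff_T f n = coeff_U g (n - 1)" if "n \<ge> 1" for n
  proof -
    have a: "r ^ n - r powi (- int n) = (q ^ n - 1) / r ^ n"
    proof -
      have "q ^ n = r ^ n * r ^ n" by (simp add: assms(3)[symmetric] power2_eq_square power_mult_distrib)
      thus ?thesis using r(3) by (simp add: power_int_minus field_simps)
    qed
    have b: "r - r powi (-1) = (q - 1) / r"
      using r(3) assms(3) by (simp add: power_int_minus power2_eq_square field_simps)
    \<comment> \<open>The cancellation in variables: x = q^n - 1, y = r^n, z = q - 1. Both
      differences are nonzero because |q| < 1 and n \<ge> 1.\<close>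
    have "x / y / (z / r) * (- z / r * (y / - x) * w) = w"
      if "x \<noteq> 0" "y \<noteq> 0" "z \<noteq> 0" for w x y z :: complex
      using that r(3) by simp
    from this[of "q ^ n - 1" "r ^ n" "q - 1" "coeff_U g (n - 1)"]
    show ?thesis unfolding a b coeff[OF that] d_def using r(3) qn[OF that] qn[of 1] by simp
  qed
  \<comment> \<open>g itself satisfies the condition from which \<open>q_deriv\<close> chooses, so
    the choice is well founded; completeness then forces the chosen function to agree with g almost
    everywhere.\<close>
  have "?P g" using assms(4) factor by simp
  hence "?P (q_deriv r f)" unfolding q_deriv_def by (rule someI[of ?P])
  hence "q_deriv r f \<in> L2_weight wU" "coeff_U (q_deriv r f) n = coeff_U g n" for n
    using factor[of "Suc n"] by (auto dest: spec[of _ "Suc n"])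
  hence "AE x in lebesgue_on {-1..1}. q_deriv r f x = g x"
    by (intro coeff_U_inj assms(4)) auto
  thus ?thesis using qd by (simp add: f_def)
qed

end
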